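(* For every integer $\ell\ge0$ the coefficients of the Laurent polynomial $b_\ell(T)$ are rational linear combinations of products of single zeta values. They are explicitly given by $$b_\ell(T)=\sum_{\substack{a+b+c+d=\ell\\ a,b,c,d\ge0}}\frac{\ell!}{a!\,b!\,c!\,d!}\,\frac{(-1)^{b+d}\,\zeta(2)^d}{6^c\,(2a+b+1)}\,T^{\ell-2d}+\sum_{\substack{a+b+c+d+e=\ell\\ a,b,c,d\ge0,\ e\ge1}}\frac{\ell!}{a!\,b!\,c!\,d!}\,\frac{(-1)^{b+d}\,(2a+b)!\,\zeta(2)^d}{2^{2a+b}\,6^c}\,H(2a+b+1,e)\,T^{c-a-d-1},$$ where $H(k,r)=\zeta(\underbrace{1,\ldots,1}_{r-1},k+1)$ for $k,r\ge1$.
   Context: Multiple zeta values: $\zeta(k_1,\ldots,k_m)=\sum_{0<n_1<\cdots<n_m}n_1^{-k_1}\cdots n_m^{-k_m}$. With $q=e^{2\pi i\tau}$ let $\eta(\tau)=q^{1/24}\prod_{n\ge1}(1-q^n)$ and $\theta_1(z,\tau)=2q^{1/8}\sin(\pi z)\prod_{n\ge1}(1-q^n)(1-q^ne^{2\pi i z})(1-q^ne^{-2\pi i z})$. For $\tau\in i\mathbb{R}_{>0}$ let $$P_B(z,\tau)=-\log\left|\frac{\theta_1(z,\tau)}{\eta(\tau)}\right|-\frac{i\pi}{\tau}\Big(z^2+\frac16\Big),\qquad B_\ell(\tau)=\int_{\mathbb{R}\tau/\mathbb{Z}\tau}P_B(z,\tau)^\ell\,\frac{dz}{\tau}$$ (for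 $z\in\mathbb{R}\tau$ one has $P_B(z+\tau,\tau)=P_B(z,\tau)$; the normalization is such that $B_1(\tau)=0$). With $T=\pi\tau/i$, the Laurent polynomial $b_\ell$ is the (unique) one with $B_\ell(\tau)=b_\ell(T)+O(e^{-T})$ as $T\to+\infty$; its existence is known. *)

theory Defs
  imports "HOL-Complex_Analysis.Complex_Analysis" "HOL-Library.Landau_Symbols"
    "HOL-Library.Poly_Mapping"
begin

text \<open>Only used for convergent index lists, i.e. those whose last entry is at least 2.\<close>

definition mzv :: "nat list \<Rightarrow> real" where
  "mzv ks = (\<Sum>\<^sub>\<infinity>ns\<in>{ns. length ns = length ks \<and> sorted_wrt (<) ns \<and> (\<forall>n\<in>set ns. 0 < n)}.
               \<Prod>i<length ks. 1 / real (ns ! i) ^ (ks ! i))"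

definition H :: "nat \<Rightarrow> nat \<Rightarrow> real" where
  "H k r = mzv (replicate (r - 1) 1 @ [k + 1])"

text \<open>The empty product is included, so that rational numbers count as rational linear
  combinations of elements of this set.\<close>

definition zeta_products :: "real set" where
  "zeta_products = {(\<Prod>k\<leftarrow>ks. mzv [k]) | ks. \<forall>k\<in>set ks. 2 \<le> k}"

lemma vector_space_rat_real: "vector_space (\<lambda>(q::rat) (x::real). of_rat q * x)"
  by unfold_locales (simp_all add: algebra_simps of_rat_add of_rat_mult)

definition rat_span :: "real set \<Rightarrow> real set" where
  "rat_span = module.span (\<lambda>(q::rat) (x::real). of_rat q * x)"

text \<open>\<open>qpow \<tau> r\<close> is the power \<open>q^r\<close> of \<open>q = exp (2 \<pi> i \<tau>)\<close>, in the branch fixed by \<open>\<tau>\<close>.\<close>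

definition qpow :: "complex \<Rightarrow> real \<Rightarrow> complex" where
  "qpow \<tau> r = exp (2 * of_real pi * \<i> * \<tau> * of_real r)"

text \<open>Infinite products are indexed from 0 in the library, hence \<open>Suc n\<close>.\<close>

definition dedekind_eta :: "complex \<Rightarrow> complex" where
  "dedekind_eta \<tau> = qpow \<tau> (1/24) * prodinf (\<lambda>n. 1 - qpow \<tau> 1 ^ Suc n)"

definition theta1 :: "complex \<Rightarrow> complex \<Rightarrow> complex" where
  "theta1 z \<tau> = 2 * qpow \<tau> (1/8) * sin (of_real pi * z) *
     prodinf (\<lambda>n. (1 - qpow \<tau> 1 ^ Suc n)
         * (1 - qpow \<tau> 1 ^ Suc n * exp (2 * of_real pi * \<i> * z))
         * (1 - qpow \<tau> 1 ^ Suc n * exp (- 2 * of_real pi * \<i> * z)))"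

text \<open>At the zeros of \<open>theta1\<close> the value is irrelevant, since these form a null set on the
  path of integration below.\<close>

definition P_B :: "complex \<Rightarrow> complex \<Rightarrow> complex" where
  "P_B z \<tau> = - of_real (ln (norm (theta1 z \<tau> / dedekind_eta \<tau>)))
             - \<i> * of_real pi / \<tau> * (z\<^sup>2 + 1/6)"

text \<open>The segment from \<open>0\<close> to \<open>\<tau>\<close> is a fundamental domain of \<open>\<real>\<tau> / \<int>\<tau>\<close>.\<close>

definition B :: "nat \<Rightarrow> complex \<Rightarrow> complex" where
  "B l \<tau> = contour_integral (linepath 0 \<tau>) (\<lambda>z. P_B z \<tau> ^ l / \<tau>)"

text \<open>Laurent polynomials over the reals are finitely supported maps from exponents to
  coefficients.\<close>

definition laurent_eval :: "(int \<Rightarrow>\<^sub>0 real) \<Rightarrow> real \<Rightarrow> real" where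
  "laurent_eval p T = (\<Sum>k\<in>Poly_Mapping.keys p. Poly_Mapping.lookup p k * T powi k)"

text \<open>\<open>T = \<pi> \<tau> / i\<close> means \<open>\<tau> = i T / \<pi>\<close>, so the cusp \<open>\<tau> \<rightarrow> i \<infinity>\<close> is \<open>T \<rightarrow> \<infinity>\<close>.\<close>

definition b_laurent :: "nat \<Rightarrow> (int \<Rightarrow>\<^sub>0 real)" where
  "b_laurent l = (THE p.
     (\<lambda>T::real. B l (\<i> * of_real T / of_real pi) - of_real (laurent_eval p T))
       \<in> O[at_top](\<lambda>T. of_real (exp (- T))))"

end

theory Submission
  imports Defs "HOL-Probability.Distributions"
begin

text \<open>On the segment from \<open>0\<close> to \<open>\<tau>\<close> put \<open>z = t \<tau>\<close> and \<open>g(s) = - ln (1 - exp (- 2 T s))\<close>. The product formulas give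
  \<open>P_B = A(t) + g(t) + g(1 - t) + \<rho>(t)\<close> with a quadratic polynomial \<open>A\<close>, symmetric under \<open>t \<mapsto> 1 - t\<close>,
  and \<open>\<rho> = O(exp (- 2 T))\<close>. The product \<open>g(t) g(1 - t)\<close> is also \<open>O(exp (- 2 T))\<close> up to integrable
  logarithmic singularities, so up to exponentially small terms the integral of \<open>P_B ^ l\<close> is that of \<open>A ^ l\<close>
  over \<open>[0, 1]\<close> plus twice that of \<open>(A + g) ^ l - A ^ l\<close> over \<open>[0, \<infinity>)\<close>. Both are evaluated by the
  multinomial theorem and \<open>\<integral> s ^ k (- ln (1 - exp (- s))) ^ e ds = e! k! H(k + 1, e)\<close>.

  The numbers \<open>H(k, r)\<close> are polynomials in single zeta values by Gauss's summation
  \<open>1 + \<Sum> (-1) ^ (j - 1) H(j, r) u ^ j y ^ r = \<Gamma>(1 + u) \<Gamma>(1 - y) / \<Gamma>(1 + u - y)\<close>: the logarithmic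
  derivative in \<open>y\<close> of the right-hand side is a difference of digamma functions, whose Taylor coefficients are
  zeta values, and this yields a recursion in \<open>r\<close>.\<close>

text \<open>Two obstacles shape the proof. Analytically, \<open>A\<close> grows like T while the
  integrand has logarithmic singularities at both ends, so every error bound needs a constant
  independent of T. All logarithms are therefore bounded through their values at T = 1, a factor T ^
  l is pulled out, and half of the decay exp (- 2 T) absorbs it. The rate 2 T comes from q = exp (-
  2 T). The half line becomes available only after subtracting A ^ l, because each remaining term
  then contains the decaying factor g. Algebraically, Gauss's identity comes from Euler's integral
  for Beta u (1 - y): expanding (1 - t) powr (- y) produces pochhammer y n / n!, whose coefficients
  in y are nested harmonic sums divided by n. For 0 < u and 0 < y < 1 the resulting double series
  have nonnegative terms, so summations can be exchanged; the price is that identities hold only to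
  the right of 0. Coefficients are compared from that side, once in y and once in u.\<close>

section \<open>Nested harmonic sums and multiple zeta values\<close>

text \<open>\<open>nested_harm r n\<close> is the \<open>r\<close>-th elementary symmetric polynomial in \<open>1, 1/2, \<dots>, 1/(n - 1)\<close>.\<close>

fun nested_harm :: "nat \<Rightarrow> nat \<Rightarrow> real" where
  "nested_harm 0 n = 1"
| "nested_harm (Suc r) n = (\<Sum>j=1..<n. nested_harm r j / real j)"

lemma nested_harm_nonneg: "0 \<le> nested_harm r n"
  by (induction r arbitrary: n) (auto intro!: sum_nonneg)

lemma nested_harm_Suc_Suc:
  "n \<ge> 1 \<Longrightarrow> nested_harm (Suc r) (Suc n) = nested_harm (Suc r) n + nested_harm r n / real n"
  by (simp add: atLeastLessThanSuc)

lemma nested_harm_le: "n \<ge> 1 \<Longrightarrow> nested_harm r n \<le> real n"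
proof (induction r arbitrary: n)
  case (Suc r)
  have "nested_harm (Suc r) n \<le> (\<Sum>j=1..<n. 1)"
    unfolding nested_harm.simps using Suc.IH by (intro sum_mono) (auto simp: field_simps)
  also have "\<dots> \<le> real n" by simp
  finally show ?case .
qed auto

text \<open>The true growth is a power of ln n; any exponent below 1 would make division by n ^ 2
  summable. The factor 4 per level comes from the telescoping bound 1 / sqrt n <= 4 (sqrt (n + 1) -
  sqrt n).\<close>

lemma nested_harm_le_sqrt: "n \<ge> 1 \<Longrightarrow> nested_harm r n \<le> 4 ^ r * sqrt (real n)"
proof (induction r arbitrary: n)
  case (Suc r)
  show ?case using Suc.prems
  proof (induction n rule: dec_induct)
    case (step n)
    have "sqrt (Suc n) \<le> sqrt (4 * real n)" using step by simp
    also have "\<dots> = 2 * sqrt n" by (simp add: real_sqrt_mult)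
    finally have 1: "sqrt (Suc n) \<le> 2 * sqrt n" .
    have sq: "sqrt n * sqrt n = n" "sqrt (Suc n) * sqrt (Suc n) = n + 1" "sqrt n > 0"
      using step by auto
    have "(sqrt (Suc n) - sqrt n) * (sqrt (Suc n) + sqrt n) = 1"
      using sq by (simp add: algebra_simps)
    moreover have "(sqrt (Suc n) - sqrt n) * (sqrt (Suc n) + sqrt n)
        \<le> (sqrt (Suc n) - sqrt n) * (3 * sqrt n)"
      using 1 by (intro mult_left_mono) auto
    ultimately have "1 \<le> 3 * ((sqrt (Suc n) - sqrt n) * sqrt n)" by linarith
    hence "1 / sqrt n \<le> (sqrt (Suc n) - sqrt n) * 3"
      by (subst pos_divide_le_eq[OF sq(3)]) (simp only: mult_ac)
    also have "\<dots> \<le> (sqrt (Suc n) - sqrt n) * 4"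
      by (intro mult_left_mono) auto
    finally have 2: "1 / sqrt n \<le> 4 * (sqrt (Suc n) - sqrt n)"
      by (simp only: mult.commute)
    have "nested_harm r n / n \<le> 4 ^ r * sqrt n / n"
      using Suc.IH[of n] step by (intro divide_right_mono) auto
    also have "\<dots> = 4 ^ r * (1 / sqrt n)"
      using sq by (simp add: field_simps)
    also have "\<dots> \<le> 4 ^ r * (4 * (sqrt (Suc n) - sqrt n))"
      using 2 by (intro mult_left_mono) auto
    finally have "nested_harm r n / n \<le> 4 ^ Suc r * sqrt (Suc n) - 4 ^ Suc r * sqrt n"
      by (simp add: algebra_simps)
    thus ?case using nested_harm_Suc_Suc[of n r] step by linarith
  qed auto
qed auto

lemma summable_nested_harm:
  assumes "k \<ge> 2"
  shows "summable (\<lambda>n. nested_harm r n / real n ^ k)"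
proof (rule summable_comparison_test)
  show "summable (\<lambda>n. 4 ^ r * real n powr (-3/2))"
    by (intro summable_mult) (simp add: summable_real_powr_iff)
  have "norm (nested_harm r n / real n ^ k) \<le> 4 ^ r * real n powr (-3/2)" if n: "n \<ge> 1" for n
  proof -
    have "nested_harm r n / real n ^ k \<le> 4 ^ r * sqrt n / real n ^ 2"
      using n assms nested_harm_le_sqrt[of n r]
      by (intro frac_le) (auto intro: nested_harm_nonneg power_increasing)
    also have "\<dots> = 4 ^ r * (sqrt n / real n ^ 2)" by simp
    also have "sqrt n / real n ^ 2 = real n powr (1/2) / real n powr 2"
      using n by (simp add: powr_half_sqrt powr_numeral)
    also have "\<dots> = real n powr (-3/2)"
      unfolding powr_diff[symmetric] by simp
    finally have "nested_harm r n / real n ^ k \<le> 4 ^ r * real n powr (-3/2)"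
      by simp
    thus ?thesis using nested_harm_nonneg[of r n] by simp
  qed
  thus "\<exists>N. \<forall>n\<ge>N. norm (nested_harm r n / real n ^ k) \<le> 4 ^ r * real n powr (-3/2)" by blast
qed

text \<open>The strict upper bound lets \<open>n\<close> itself be appended to such a list, so
  splitting off the largest index becomes a bijection.\<close>

definition inc_lists :: "nat \<Rightarrow> nat \<Rightarrow> nat list set" where
  "inc_lists r n = {ns. length ns = r \<and> sorted_wrt (<) ns \<and> (\<forall>x\<in>set ns. 0 < x \<and> x < n)}"

lemma finite_inc_lists: "finite (inc_lists r n)"
  by (rule finite_subset[OF _ finite_lists_length_eq[of "{..<n}" r]]) (auto simp: inc_lists_def)

lemma bij_inc_lists:
  "bij_betw (\<lambda>(j, ns). ns @ [j]) (SIGMA j:{1..<n}. inc_lists r j) (inc_lists (Suc r) n)"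
proof (rule bij_betw_byWitness[where f' = "\<lambda>ns. (last ns, butlast ns)"])
  show "(\<lambda>ns. (last ns, butlast ns)) ` inc_lists (Suc r) n \<subseteq> (SIGMA j:{1..<n}. inc_lists r j)"
  proof safe
    fix ns assume ns: "ns \<in> inc_lists (Suc r) n"
    then obtain xs x where "ns = xs @ [x]"
      by (cases ns rule: rev_cases) (auto simp: inc_lists_def)
    with ns show "last ns \<in> {1..<n}" "butlast ns \<in> inc_lists r (last ns)"
      by (auto simp: inc_lists_def sorted_wrt_append)
  qed
  show "(\<lambda>(j, ns). ns @ [j]) ` (SIGMA j:{1..<n}. inc_lists r j) \<subseteq> inc_lists (Suc r) n"
    by (fastforce simp: inc_lists_def sorted_wrt_append)
  show "\<forall>ns\<in>inc_lists (Suc r) n. (case (last ns, butlast ns) of (j, ns) \<Rightarrow> ns @ [j]) = ns"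
  proof
    fix ns assume "ns \<in> inc_lists (Suc r) n"
    thus "(case (last ns, butlast ns) of (j, ns) \<Rightarrow> ns @ [j]) = ns"
      by (cases ns rule: rev_cases) (auto simp: inc_lists_def)
  qed
  show "\<forall>a\<in>SIGMA j:{1..<n}. inc_lists r j. (\<lambda>ns. (last ns, butlast ns)) (case a of (j, ns) \<Rightarrow> ns @ [j]) = a"
    by auto
qed

lemma sum_inc_lists:
  "(\<Sum>ns\<in>inc_lists r n. \<Prod>i<r. 1 / real (ns ! i)) = nested_harm r n"
proof (induction r arbitrary: n)
  case 0
  have "inc_lists 0 n = {[]}" by (auto simp: inc_lists_def)
  thus ?case by simp
next
  case (Suc r)
  have "(\<Sum>ns\<in>inc_lists (Suc r) n. \<Prod>i<Suc r. 1 / real (ns ! i)) =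
      (\<Sum>(j, ns)\<in>(SIGMA j:{1..<n}. inc_lists r j). \<Prod>i<Suc r. 1 / real ((ns @ [j]) ! i))"
    by (subst sum.reindex_bij_betw[OF bij_inc_lists, symmetric]) (simp add: case_prod_unfold)
  also have "\<dots> = (\<Sum>(j, ns)\<in>(SIGMA j:{1..<n}. inc_lists r j). (\<Prod>i<r. 1 / real (ns ! i)) / j)"
    by (intro sum.cong) (auto simp: inc_lists_def nth_append intro!: prod.cong)
  also have "\<dots> = (\<Sum>j=1..<n. \<Sum>ns\<in>inc_lists r j. (\<Prod>i<r. 1 / real (ns ! i)) / j)"
    by (subst sum.Sigma) (auto simp: finite_inc_lists)
  also have "\<dots> = nested_harm (Suc r) n"
    using Suc by (simp add: sum_divide_distrib[symmetric] del: prod_dividef)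
  finally show ?case .
qed

lemma bij_inc_lists_UNIV:
  "bij_betw (\<lambda>(j, ns). ns @ [j]) (SIGMA j:{1..}. inc_lists r j)
     {ns. length ns = Suc r \<and> sorted_wrt (<) ns \<and> (\<forall>n\<in>set ns. 0 < n)}"
proof (rule bij_betw_byWitness[where f' = "\<lambda>ns. (last ns, butlast ns)"])
  show "(\<lambda>ns. (last ns, butlast ns)) ` {ns. length ns = Suc r \<and> sorted_wrt (<) ns \<and> (\<forall>n\<in>set ns. 0 < n)}
     \<subseteq> (SIGMA j:{1..}. inc_lists r j)"
  proof (rule image_subsetI)
    fix ns :: "nat list" assume ns: "ns \<in> {ns. length ns = Suc r \<and> sorted_wrt (<) ns \<and> (\<forall>n\<in>set ns. 0 < n)}"
    then obtain xs x where "ns = xs @ [x]"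
      by (cases ns rule: rev_cases) auto
    with ns show "(last ns, butlast ns) \<in> (SIGMA j:{1..}. inc_lists r j)"
      by (auto simp: inc_lists_def sorted_wrt_append)
  qed
  show "(\<lambda>(j, ns). ns @ [j]) ` (SIGMA j:{1..}. inc_lists r j) \<subseteq> 
      {ns. length ns = Suc r \<and> sorted_wrt (<) ns \<and> (\<forall>n\<in>set ns. 0 < n)}"
    by (auto simp: inc_lists_def sorted_wrt_append)
  show "\<forall>ns\<in>{ns :: nat list. length ns = Suc r \<and> sorted_wrt (<) ns \<and> (\<forall>n\<in>set ns. 0 < n)}. 
      (case (last ns, butlast ns) of (j, ns) \<Rightarrow> ns @ [j]) = ns"
  proof
    fix ns :: "nat list" assume "ns \<in> {ns. length ns = Suc r \<and> sorted_wrt (<) ns \<and> (\<forall>n\<in>set ns. 0 < n)}"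
    thus "(case (last ns, butlast ns) of (j, ns) \<Rightarrow> ns @ [j]) = ns"
      by (cases ns rule: rev_cases) auto
  qed
  show "\<forall>a\<in>SIGMA j:{1..}. inc_lists r j. (\<lambda>ns. (last ns, butlast ns)) (case a of (j, ns) \<Rightarrow> ns @ [j]) = a"
    by auto
qed

text \<open>Grouping the index lists by their largest entry j leaves a finite inner sum, which is
  \<open>nested_harm r j\<close> by \<open>sum_inc_lists\<close>. Nonnegativity provides the
  unordered summability needed to sum over j afterwards.\<close>

lemma H_sums:
  assumes "k \<ge> 1"
  shows "(\<lambda>n. nested_harm r n / real n ^ (k + 1)) sums H k (Suc r)"
proof -
  define f where "f = (\<lambda>n. nested_harm r n / real n ^ (k + 1))"
  define w where "w = (\<lambda>ns::nat list. \<Prod>i<length (replicate r 1 @ [k + 1]).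
      1 / real (ns ! i) ^ ((replicate r 1 @ [k + 1]) ! i))"
  have w: "w (ns @ [j]) = (\<Prod>i<r. 1 / real (ns ! i)) / real j ^ (k + 1)"
    if "ns \<in> inc_lists r j" for ns j
    using that unfolding w_def by (auto simp: inc_lists_def nth_append intro!: prod.cong)
  have f: "f summable_on UNIV"
    using summable_nested_harm[of "k+1" r] assms unfolding f_def
    by (subst summable_on_UNIV_nonneg_real_iff) (auto intro!: divide_nonneg_nonneg nested_harm_nonneg)
  \<comment> \<open>The index 0 contributes nothing because division by zero yields 0.\<close>
  have "(f has_sum (\<Sum>\<^sub>\<infinity>n. f n)) {1..} \<longleftrightarrow> (f has_sum (\<Sum>\<^sub>\<infinity>n. f n)) UNIV"
    by (rule has_sum_cong_neutral) (auto simp: f_def not_le)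
  hence f1: "(f has_sum (\<Sum>\<^sub>\<infinity>n. f n)) {1..}"
    using f by simp
  have inner: "((\<lambda>ns. (case (j, ns) of (j, ns) \<Rightarrow> w (ns @ [j]))) has_sum f j) (inc_lists r j)" for j
  proof -
    have "(\<Sum>ns\<in>inc_lists r j. w (ns @ [j])) = f j"
      unfolding f_def sum_inc_lists[symmetric]
      by (simp add: w sum_divide_distrib del: prod_dividef)
    thus ?thesis using has_sum_finite[OF finite_inc_lists, of "\<lambda>ns. w (ns @ [j])" r j] by simp
  qed
  have "((\<lambda>(j, ns). w (ns @ [j])) has_sum (\<Sum>\<^sub>\<infinity>n. f n)) (SIGMA j:{1..}. inc_lists r j)"
  proof (rule has_sum_SigmaI[OF inner f1])
    show "(\<lambda>(j, ns). w (ns @ [j])) summable_on (SIGMA j:{1..}. inc_lists r j)"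
      by (rule summable_on_SigmaI[OF inner has_sum_imp_summable[OF f1]])
         (auto simp: w_def simp del: prod_dividef prod.lessThan_Suc length_append intro!: prod_nonneg)
  qed
  hence "(w has_sum (\<Sum>\<^sub>\<infinity>n. f n)) {ns. length ns = Suc r \<and> sorted_wrt (<) ns \<and> (\<forall>n\<in>set ns. 0 < n)}"
    using has_sum_reindex_bij_betw[OF bij_inc_lists_UNIV, of w r] by (simp add: case_prod_unfold)
  hence "H k (Suc r) = (\<Sum>\<^sub>\<infinity>n. f n)"
    unfolding H_def mzv_def w_def by (simp add: infsumI)
  moreover have "(f has_sum (\<Sum>\<^sub>\<infinity>n. f n)) UNIV" using f by simp
  ultimately show ?thesis unfolding f_def[symmetric] by (metis has_sum_imp_sums)
qed

lemma mzv_single_sums: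
  assumes "k \<ge> 2"
  shows "(\<lambda>n. 1 / real n ^ k) sums mzv [k]"
  using H_sums[of "k - 1" 0] assms by (simp add: H_def)

text \<open>Both sides vanish at 0 and have the same derivative: differentiating the right-hand side
  leaves the previous power times 1 / (1 - x), and multiplying a power series by the geometric
  series forms partial sums of its coefficients, which is the recursion of
  \<open>nested_harm\<close>.\<close>

lemma sums_log_power:
  fixes x :: real
  assumes "\<bar>x\<bar> < 1"
  shows "(\<lambda>n. nested_harm r n / real n * x ^ n) sums ((- ln (1 - x)) ^ Suc r / fact (Suc r))"
  using assms
proof (induction r arbitrary: x)
  case 0
  have "(\<lambda>n. - (- ((- (- x)) ^ n) / of_nat n)) sums (- ln (1 + - x))"
    by (intro sums_minus ln_series') (use 0 in simp)
  thus ?case by (simp add: field_simps)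
next
  case (Suc r)
  define a where "a = (\<lambda>n. nested_harm (Suc r) n / real n)"
  define f where "f = (\<lambda>x::real. suminf (\<lambda>n. a n * x ^ n))"
  define L where "L = (\<lambda>x::real. (- ln (1 - x)) ^ Suc (Suc r) / fact (Suc (Suc r)))"
  have bd: "norm (nested_harm q n / real n) \<le> 1" for n q
    using nested_harm_le[of n q] nested_harm_nonneg[of q n] by (cases "n = 0") (auto simp: field_simps)
  have sm: "summable (\<lambda>n. norm (nested_harm q n / real n * x ^ n))" if "norm x < 1" for x :: real and q
  proof (rule summable_comparison_test)
    show "summable (\<lambda>n. norm x ^ n)" using that by (intro summable_geometric) auto
    have "norm (norm (nested_harm q n / real n * x ^ n)) \<le> norm x ^ n" for n
      using bd[of q n] mult_right_mono[of "norm (nested_harm q n / real n)" 1 "norm x ^ n"] 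
      by (simp add: norm_mult norm_power abs_mult power_abs)
    thus "\<exists>N. \<forall>n\<ge>N. norm (norm (nested_harm q n / real n * x ^ n)) \<le> norm x ^ n" by blast
  qed
  have deriv: "((\<lambda>x. f x - L x) has_field_derivative 0) (at x)" if x: "\<bar>x\<bar> < 1" for x
  proof -
    have "(\<lambda>n. \<Sum>i\<le>n. (nested_harm r i / real i * x ^ i) * x ^ (n - i)) sums
        (suminf (\<lambda>n. nested_harm r n / real n * x ^ n) * suminf (\<lambda>n. x ^ n))"
      by (intro Cauchy_product_sums sm) (use x in \<open>auto simp: norm_power power_abs intro!: summable_geometric\<close>)
    also have "(\<lambda>n. \<Sum>i\<le>n. (nested_harm r i / real i * x ^ i) * x ^ (n - i)) =
        (\<lambda>n. nested_harm (Suc r) (Suc n) * x ^ n)"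
    proof
      fix n
      have "(\<Sum>i\<le>n. (nested_harm r i / real i * x ^ i) * x ^ (n - i)) =
          (\<Sum>i\<le>n. nested_harm r i / real i) * x ^ n"
        by (simp add: sum_distrib_right mult.assoc flip: power_add)
      also have "(\<Sum>i\<le>n. nested_harm r i / real i) = (\<Sum>i=1..<Suc n. nested_harm r i / real i)"
        by (intro sum.mono_neutral_right) auto
      finally show "(\<Sum>i\<le>n. (nested_harm r i / real i * x ^ i) * x ^ (n - i)) =
          nested_harm (Suc r) (Suc n) * x ^ n" by simp
    qed
    also have "suminf (\<lambda>n. nested_harm r n / real n * x ^ n) = (- ln (1 - x)) ^ Suc r / fact (Suc r)"
      using Suc.IH[OF x] by (simp add: sums_iff)
    also have "suminf (\<lambda>n. x ^ n) = 1 / (1 - x)"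
      using x by (intro suminf_geometric) auto
    finally have S: "(\<lambda>n. diffs a n * x ^ n) sums ((- ln (1 - x)) ^ Suc r / fact (Suc r) * (1 / (1 - x)))"
      by (simp add: diffs_def a_def del: nested_harm.simps)
    have sm': "summable (\<lambda>n. a n * z ^ n)" if "norm z < 1" for z
      unfolding a_def by (rule summable_norm_cancel[OF sm[OF that]])
    have D1: "(f has_field_derivative suminf (\<lambda>n. diffs a n * x ^ n)) (at x)"
      unfolding f_def by (rule termdiffs_strong'[OF sm', of 1]) (use x in auto)
    have "(L has_field_derivative ((- ln (1 - x)) ^ Suc r / fact (Suc r) * (1 / (1 - x)))) (at x)"
    proof -
      have "((\<lambda>x. - ln (1 - x)) has_field_derivative 1 / (1 - x)) (at x)"
        using x by (auto intro!: derivative_eq_intros)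
      from DERIV_cdivide[OF DERIV_power[OF this, of "Suc (Suc r)"], of "fact (Suc (Suc r))"]
      show ?thesis unfolding L_def
        by (rule DERIV_cong) (simp add: fact_Suc[of "Suc r"] del: fact_Suc power_Suc of_nat_Suc)
    qed
    with D1 S show ?thesis
      by (auto intro!: derivative_eq_intros simp: sums_iff)
  qed
  have "f x - L x = f 0 - L 0"
    by (rule DERIV_isconst3[of "-1" 1]) (use Suc.prems deriv in \<open>auto simp: abs_less_iff\<close>)
  also have "\<dots> = 0"
    by (simp add: f_def L_def powser_zero) (simp add: a_def)
  finally have "f x = L x" by simp
  moreover have "summable (\<lambda>n. a n * x ^ n)"
    unfolding a_def by (rule summable_norm_cancel[OF sm]) (use Suc.prems in auto)
  ultimately show ?case unfolding f_def L_def a_def by (simp add: sums_iff)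
qed

text \<open>The limit is the product of 1 + y / j over 1 <= j < n, so the series is the expansion of
  this product in elementary symmetric polynomials. Passing from n to n + 1 multiplies by 1 + y /
  n.\<close>

lemma sums_nested_harm_generating_function:
  assumes "n \<ge> 1"
  shows "(\<lambda>r. nested_harm r n * y ^ r) sums (pochhammer (y + 1) (n - 1) / fact (n - 1))"
  using assms
proof (induction n rule: dec_induct)
  case base
  have "(\<lambda>r. nested_harm r 1 * y ^ r) sums (\<Sum>r\<in>{0}. nested_harm r 1 * y ^ r)"
    by (rule sums_finite) (auto simp: gr0_conv_Suc)
  thus ?case by simp
next
  case (step n)
  have "(\<lambda>r. nested_harm (Suc r) n * y ^ Suc r) sums 
      (pochhammer (y + 1) (n - 1) / fact (n - 1) - 1)"
    using step.IH by (subst sums_Suc_iff) simp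
  from sums_add[OF this sums_mult[OF step.IH, of "y / n"]]
  have "(\<lambda>r. nested_harm (Suc r) (Suc n) * y ^ Suc r) sums 
      (pochhammer (y + 1) (n - 1) / fact (n - 1) - 1 + y / n * (pochhammer (y + 1) (n - 1) / fact (n - 1)))"
    using step(1) by (simp only: nested_harm_Suc_Suc) (simp add: field_simps)
  hence "(\<lambda>r. nested_harm r (Suc n) * y ^ r) sums 
      (pochhammer (y + 1) (n - 1) / fact (n - 1) + y / n * (pochhammer (y + 1) (n - 1) / fact (n - 1)))"
    by (subst (asm) sums_Suc_iff) simp
  also have "(pochhammer (y + 1) (n - 1) / fact (n - 1) + y / n * (pochhammer (y + 1) (n - 1) / fact (n - 1)))
     = pochhammer (y + 1) (Suc n - 1) / fact (Suc n - 1)"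
  proof -
    obtain m where n: "n = Suc m" using step(1) by (cases n) auto
    show ?thesis unfolding n
      by (simp add: pochhammer_Suc divide_simps) (simp add: algebra_simps)
  qed
  finally show ?case .
qed

section \<open>Gauss summation\<close>

text \<open>Fubini for an absolutely convergent double series. The proof passes to unordered sums
  over pairs, where exchanging the indices is a reindexing, and returns to ordered series at the
  end.\<close>

lemma sums_swap:
  fixes f :: "nat \<Rightarrow> nat \<Rightarrow> real"
  assumes abs: "\<And>m. (\<lambda>n. \<bar>f m n\<bar>) sums G m" and G: "summable G"
    and f: "\<And>m. f m sums g m" and h: "\<And>n. (\<lambda>m. f m n) sums h n"
  shows "h sums suminf g"
proof -
  have nonneg: "0 \<le> G m" for m
    using sums_le[OF _ sums_zero abs[of m]] by simp
  have hs: "((\<lambda>n. f m n) has_sum g m) UNIV" for m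
    using f abs by (simp add: norm_summable_imp_has_sum sums_iff)
  have "(\<lambda>(m, n). \<bar>f m n\<bar>) summable_on (UNIV \<times> UNIV)"
  proof (rule summable_on_SigmaI)
    show "((\<lambda>n. case (m, n) of (m, n) \<Rightarrow> \<bar>f m n\<bar>) has_sum G m) UNIV" for m
      using sums_nonneg_imp_has_sum[OF abs] by simp
    show "G summable_on UNIV"
      using G nonneg by (simp add: summable_on_UNIV_nonneg_real_iff)
  qed auto
  hence sm: "(\<lambda>(m, n). f m n) summable_on (UNIV \<times> UNIV)"
    using summable_on_iff_abs_summable_on_real[of "\<lambda>(m, n). f m n" "UNIV \<times> UNIV"]
    by (simp add: case_prod_unfold)
  have "((\<lambda>(m, n). f m n) has_sum (infsum g UNIV)) (UNIV \<times> UNIV)"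
  proof (rule has_sum_SigmaI)
    show "((\<lambda>n. case (m, n) of (m, n) \<Rightarrow> f m n) has_sum g m) UNIV" for m
      using hs by simp
    show "(g has_sum infsum g UNIV) UNIV"
      using has_sum_SigmaD[OF has_sum_infsum[OF sm], of g] hs by (auto simp: has_sum_iff)
  qed (use sm in simp)
  hence S: "((\<lambda>(n, m). f m n) has_sum (infsum g UNIV)) (UNIV \<times> UNIV)"
    by (subst (asm) has_sum_swap) (simp add: case_prod_unfold)
  have "(h has_sum infsum g UNIV) UNIV"
  proof (rule has_sum_SigmaD[OF S])
    show "((\<lambda>m. case (n, m) of (n, m) \<Rightarrow> f m n) has_sum h n) UNIV" for n
    proof -
      have "(\<lambda>(n, m). f m n) summable_on (UNIV \<times> UNIV)" using S by (auto simp: summable_on_def)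
      hence "(\<lambda>m. f m n) summable_on UNIV"
        by (rule summable_on_SigmaD1) auto
      hence "((\<lambda>m. f m n) has_sum (infsum (\<lambda>m. f m n) UNIV)) UNIV" by simp
      moreover from has_sum_imp_sums[OF this] h[of n] have "infsum (\<lambda>m. f m n) UNIV = h n"
        by (simp add: sums_unique2)
      ultimately show ?thesis by simp
    qed
  qed
  from has_sum_imp_sums[OF this] have "h sums infsum g UNIV" .
  moreover have "g sums infsum g UNIV"
    using has_sum_SigmaD[OF has_sum_infsum[OF sm], of g] hs by (intro has_sum_imp_sums) (auto simp: has_sum_iff)
  ultimately show ?thesis by (simp add: sums_iff)
qed

text \<open>The Tonelli version: each entry is at most the sum of its row, so the columns converge
  by comparison with the row sums.\<close>

lemma sums_swap_nonneg:
  fixes f :: "nat \<Rightarrow> nat \<Rightarrow> real"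
  assumes "\<And>m n. 0 \<le> f m n" and "\<And>m. f m sums g m" and "g sums s"
  shows "(\<lambda>n. suminf (\<lambda>m. f m n)) sums s"
proof -
  have "(\<lambda>m. f m n) sums (suminf (\<lambda>m. f m n))" for n
  proof (rule summable_sums, rule summable_comparison_test)
    have "f m n \<le> g m" for m
      using sum_le_suminf[of "f m" "{n}"] assms by (auto simp: sums_iff)
    thus "\<exists>N. \<forall>m\<ge>N. norm (f m n) \<le> g m" using assms(1) by auto
    show "summable g" using assms(3) by (simp add: sums_iff)
  qed
  from sums_swap[of f g g, OF _ _ _ this] assms show ?thesis
    by (auto simp: sums_iff)
qed

text \<open>Once the lower coefficients agree, the difference series can be divided by y ^ n. The
  quotient vanishes for 0 < y < 1 and is continuous at 0, so its constant term vanishes too.\<close>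

lemma powser_right_unique:
  fixes a b :: "nat \<Rightarrow> real"
  assumes a: "\<And>y. 0 < y \<Longrightarrow> y < 1 \<Longrightarrow> (\<lambda>n. a n * y ^ n) sums s y"
    and b: "\<And>y. 0 < y \<Longrightarrow> y < 1 \<Longrightarrow> (\<lambda>n. b n * y ^ n) sums s y"
  shows "a n = b n"
proof (induction n rule: less_induct)
  case (less n)
  define c where "c = (\<lambda>k. a (k + n) - b (k + n))"
  have c: "(\<lambda>k. c k * y ^ k) sums 0" if y: "0 < y" "y < 1" for y
  proof -
    have "(\<lambda>k. (a k - b k) * y ^ k) sums 0"
      using sums_diff[OF a[OF y] b[OF y]] by (simp add: algebra_simps)
    from sums_split_initial_segment[OF this, of n] less
    have "(\<lambda>k. (a (k + n) - b (k + n)) * y ^ (k + n)) sums 0"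
      by simp
    from sums_mult[OF this, of "1 / y ^ n"] y show ?thesis
      by (simp add: c_def power_add)
  qed
  define f where "f = (\<lambda>y. suminf (\<lambda>k. c k * y ^ k))"
  have "isCont f 0" unfolding f_def
    by (rule isCont_powser[of _ "1/2"]) (use c[of "1/2"] in \<open>auto simp: sums_iff\<close>)
  \<comment> \<open>The shift by 2 keeps all points strictly between 0 and 1.\<close>
  hence "(\<lambda>k. f (1 / real (k + 2))) \<longlonglongrightarrow> f 0"
    by (rule isCont_tendsto_compose) real_asymp
  moreover have "f (1 / real (k + 2)) = 0" for k
    using c[of "1 / real (k + 2)"] by (simp add: f_def sums_iff)
  ultimately have "f 0 = 0" by (simp add: LIMSEQ_const_iff)
  thus ?case by (simp add: f_def c_def powser_zero)
qed

section \<open>Euler's Beta integral as a hypergeometric series\<close>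

lemma sums_pochhammer_powr:
  fixes t y :: real
  assumes "\<bar>t\<bar> < 1"
  shows "(\<lambda>n. pochhammer y n / fact n * t ^ n) sums ((1 - t) powr (- y))"
proof -
  have "(\<lambda>n. ((- y) gchoose n) * (- t) ^ n) sums ((1 + - t) powr (- y))"
    using assms by (intro gen_binomial_real) auto
  also have "(\<lambda>n. ((- y) gchoose n) * (- t) ^ n) = (\<lambda>n. pochhammer y n / fact n * t ^ n)"
    by (simp add: fun_eq_iff gbinomial_pochhammer power_mult_distrib[of "-1" t] flip: power_mult_distrib)
  finally show ?thesis by simp
qed

lemma sums_binomial_negative:
  fixes x :: real
  assumes "\<bar>x\<bar> < 1"
  shows "(\<lambda>j. real (m + j choose j) * x ^ j) sums (1 / (1 - x) ^ Suc m)"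
proof -
  have "pochhammer (real (Suc m)) j / fact j = real (m + j choose j)" for j
    by (simp add: binomial_gbinomial gbinomial_pochhammer' add_ac)
  moreover have "(1 - x) powr (- real (Suc m)) = 1 / (1 - x) ^ Suc m"
    using assms by (simp add: powr_minus powr_realpow field_simps del: of_nat_Suc power_Suc)
  ultimately show ?thesis
    using sums_pochhammer_powr[OF assms, of "real (Suc m)"] by simp
qed

text \<open>Expand (1 - t) powr (- y) in Euler's integral by the binomial series and integrate term
  by term. All terms are nonnegative, so monotone convergence suffices.\<close>

lemma sums_Beta:
  fixes u y :: real
  assumes u: "0 < u" and y: "0 < y" "y < 1"
  shows "(\<lambda>n. pochhammer y n / fact n * (1 / (real n + u))) sums Beta u (1 - y)"
proof -
  define f where "f = (\<lambda>n t. pochhammer y n / fact n * (indicator {0..1} t * t powr (real n + u - 1)))"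
  have c: "pochhammer y n / fact n \<ge> 0" for n
    using y by (auto intro!: pochhammer_nonneg divide_nonneg_nonneg)
  have "(\<integral>\<^sup>+t. f n t \<partial>lborel) = ennreal (pochhammer y n / fact n * (1 / (real n + u)))" for n
  proof -
    have "((\<lambda>t. t powr (real n + u - 1)) has_integral (1 powr (real n + u - 1 + 1) / (real n + u - 1 + 1))) {0..1::real}"
      by (rule has_integral_powr_from_0) (use u in auto)
    from nn_integral_has_integral_lebesgue[OF _ this]
    have "(\<integral>\<^sup>+t. ennreal (indicator {0..1} t * t powr (real n + u - 1)) \<partial>lborel) = ennreal (1 / (real n + u))"
      by simp
    hence "ennreal (pochhammer y n / fact n) * (\<integral>\<^sup>+t. ennreal (indicator {0..1} t * t powr (real n + u - 1)) \<partial>lborel)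
       = ennreal (pochhammer y n / fact n * (1 / (real n + u)))"
      using c[of n] u by (simp only: ennreal_mult[symmetric] zero_le_divide_1_iff)
    also have "ennreal (pochhammer y n / fact n) * (\<integral>\<^sup>+t. ennreal (indicator {0..1} t * t powr (real n + u - 1)) \<partial>lborel)
       = (\<integral>\<^sup>+t. ennreal (pochhammer y n / fact n) * ennreal (indicator {0..1} t * t powr (real n + u - 1)) \<partial>lborel)"
      by (subst nn_integral_cmult) auto
    also have "\<dots> = (\<integral>\<^sup>+t. f n t \<partial>lborel)"
      unfolding f_def using c by (intro nn_integral_cong ennreal_mult[symmetric]) auto
    finally show ?thesis .
  qed
  hence "suminf (\<lambda>n. ennreal (pochhammer y n / fact n * (1 / (real n + u)))) = suminf (\<lambda>n. (\<integral>\<^sup>+t. f n t \<partial>lborel))"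
    by simp
  also have "\<dots> = (\<integral>\<^sup>+t. suminf (\<lambda>n. ennreal (f n t)) \<partial>lborel)"
    by (subst nn_integral_suminf) (auto simp: f_def)
  also have "\<dots> = (\<integral>\<^sup>+t. ennreal (indicator {0..1} t * (t powr (u - 1) * (1 - t) powr ((1 - y) - 1))) \<partial>lborel)"
  \<comment> \<open>At t = 1 the series diverges whereas \<open>powr\<close> with base 0 returns 0,
    so the identity is claimed only almost everywhere.\<close>
  proof (rule nn_integral_cong_AE, use AE_lborel_singleton[of 0] AE_lborel_singleton[of 1] in eventually_elim)
    fix t :: real assume t: "t \<noteq> 0" "t \<noteq> 1"
    show "suminf (\<lambda>n. ennreal (f n t)) = ennreal (indicator {0..1} t * (t powr (u - 1) * (1 - t) powr ((1 - y) - 1)))"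
    proof (cases "t \<in> {0..1}")
      case True
      hence t': "0 < t" "t < 1" using t by auto
      have "(\<lambda>n. t powr (u - 1) * (pochhammer y n / fact n * t ^ n)) sums (t powr (u - 1) * (1 - t) powr (- y))"
        using t' by (intro sums_mult sums_pochhammer_powr) auto
      also have "(\<lambda>n. t powr (u - 1) * (pochhammer y n / fact n * t ^ n)) = (\<lambda>n. f n t)"
      proof
        fix n
        have "t powr (real n + u - 1) = t ^ n * t powr (u - 1)"
          using t' by (simp add: powr_add powr_diff powr_realpow)
        thus "t powr (u - 1) * (pochhammer y n / fact n * t ^ n) = f n t"
          using True by (simp add: f_def mult_ac)
      qed
      finally have "(\<lambda>n. ennreal (f n t)) sums ennreal (t powr (u - 1) * (1 - t) powr (- y))"
        by (subst sums_ennreal) (auto simp only: f_def intro!: mult_nonneg_nonneg c powr_ge_zero indicator_pos_le)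
      thus ?thesis using True by (simp add: sums_iff)
    next
      case False
      thus ?thesis by (simp add: f_def)
    qed
  qed
  also have "\<dots> = ennreal (Beta u (1 - y))"
    by (rule nn_integral_has_integral_lebesgue) (use has_integral_Beta_real[of u "1 - y"] assms in auto)
  finally have "suminf (\<lambda>n. ennreal (pochhammer y n / fact n * (1 / (real n + u)))) = ennreal (Beta u (1 - y))" .
  hence "(\<lambda>n. ennreal (pochhammer y n / fact n * (1 / (real n + u)))) sums ennreal (Beta u (1 - y))"
    using summable_sums[of "\<lambda>n. ennreal (pochhammer y n / fact n * (1 / (real n + u)))"] by simp
  thus ?thesis
    by (subst (asm) sums_ennreal)
       (use c u y in \<open>auto simp: Beta_def intro!: divide_nonneg_nonneg pochhammer_nonneg Gamma_real_nonneg\<close>)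
qed

text \<open>The coefficients of \<open>y ^ r\<close> in \<open>u * Beta u (1 - y)\<close> and of \<open>y ^ m\<close> in
  \<open>Digamma (1 + u - y) - Digamma (1 - y)\<close>; the Taylor coefficients of both in \<open>u\<close> are called
  \<open>gauss_taylor\<close> and \<open>digamma_taylor\<close> below.\<close>

definition gauss_coeff :: "nat \<Rightarrow> real \<Rightarrow> real" where
  "gauss_coeff r u = (case r of 0 \<Rightarrow> 1 | Suc q \<Rightarrow> suminf (\<lambda>n. nested_harm q n / real n * (u / (real n + u))))"

definition digamma_coeff :: "nat \<Rightarrow> real \<Rightarrow> real" where
  "digamma_coeff m u = suminf (\<lambda>n. 1 / real (Suc n) ^ Suc m - 1 / (real (Suc n) + u) ^ Suc m)"

lemma summable_gauss_coeff:
  assumes u: "0 < u"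
  shows "summable (\<lambda>n. nested_harm r n / real n * (u / (real n + u)))"
proof (rule summable_comparison_test)
  show "summable (\<lambda>n. u * (nested_harm r n / real n ^ 2))"
    by (intro summable_mult summable_nested_harm) auto
  have "norm (nested_harm r n / real n * (u / (real n + u))) \<le> u * (nested_harm r n / real n ^ 2)" for n
  proof (cases "n = 0")
    case False
    have "nested_harm r n / real n * (u / (real n + u)) \<le> nested_harm r n / real n * (u / real n)"
      using u False by (intro mult_left_mono divide_left_mono) (auto intro!: divide_nonneg_nonneg nested_harm_nonneg)
    thus ?thesis using u by (simp add: power2_eq_square nested_harm_nonneg mult_ac)
  qed auto
  thus "\<exists>N. \<forall>n\<ge>N. norm (nested_harm r n / real n * (u / (real n + u))) \<le> u * (nested_harm r n / real n ^ 2)"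
    by blast
qed

text \<open>Writing pochhammer y n / n! as y / n times the product of 1 + y / j over j < n and
  expanding the product gives a double series in n and r with nonnegative terms; exchanging the sums
  collects the powers of y.\<close>

lemma gauss_sums:
  fixes u y :: real
  assumes u: "0 < u" and y: "0 < y" "y < 1"
  shows "(\<lambda>r. gauss_coeff r u * y ^ r) sums (u * Beta u (1 - y))"
proof -
  define f where "f = (\<lambda>n r. nested_harm r n * y ^ Suc r / real n * (u / (real n + u)))"
  \<comment> \<open>The term n = 0 of the Beta series equals 1 after multiplication by u. It is set
    to 0 here and comes back as \<open>gauss_coeff 0 u\<close>.\<close>
  define g where "g = (\<lambda>n. if n = 0 then 0 else u * (pochhammer y n / fact n * (1 / (real n + u))))"
  have fg: "f n sums g n" for n
  proof (cases "n = 0")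
    case False
    have "(\<lambda>r. nested_harm r n * y ^ r) sums (pochhammer (y + 1) (n - 1) / fact (n - 1))"
      using False by (intro sums_nested_harm_generating_function) auto
    from sums_mult[OF this, of "y / n * (u / (real n + u))"]
    have "f n sums (y / n * (u / (real n + u)) * (pochhammer (y + 1) (n - 1) / fact (n - 1)))"
      by (simp add: f_def mult_ac)
    also have "y / n * (u / (real n + u)) * (pochhammer (y + 1) (n - 1) / fact (n - 1)) = g n"
    proof -
      obtain m where n: "n = Suc m" using False by (cases n) auto
      show ?thesis unfolding g_def n pochhammer_rec[of y] by (simp add: field_simps)
    qed
    finally show ?thesis .
  qed (simp add: f_def g_def)
  have "(\<lambda>n. u * (pochhammer y n / fact n * (1 / (real n + u)))) sums (u * Beta u (1 - y))"
    by (intro sums_mult sums_Beta assms)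
  hence "(\<lambda>n. u * (pochhammer y (Suc n) / fact (Suc n) * (1 / (real (Suc n) + u)))) sums (u * Beta u (1 - y) - 1)"
    by (subst sums_Suc_iff) (use u in simp)
  hence "(\<lambda>n. g (Suc n)) sums (u * Beta u (1 - y) - 1)"
    by (simp add: g_def)
  hence "g sums (u * Beta u (1 - y) - 1)"
    by (subst (asm) sums_Suc_iff) (simp add: g_def)
  from sums_swap_nonneg[OF _ fg this]
  have "(\<lambda>r. suminf (\<lambda>n. f n r)) sums (u * Beta u (1 - y) - 1)"
    using u y by (simp add: f_def nested_harm_nonneg)
  also have "(\<lambda>r. suminf (\<lambda>n. f n r)) = (\<lambda>r. gauss_coeff (Suc r) u * y ^ Suc r)"
  proof
    fix r
    have "summable (\<lambda>n. nested_harm r n / real n * (u / (real n + u)))"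
      by (rule summable_gauss_coeff[OF u])
    from suminf_mult2[OF this, of "y ^ Suc r"]
    show "suminf (\<lambda>n. f n r) = gauss_coeff (Suc r) u * y ^ Suc r"
      by (simp add: f_def gauss_coeff_def mult_ac)
  qed
  finally show ?thesis
    by (subst (asm) sums_Suc_iff) (simp add: gauss_coeff_def)
qed

lemma sums_inverse_shift_real:
  fixes a b :: real
  assumes "0 < a" "0 < b"
  shows "(\<lambda>n. 1 / (real n + a) - 1 / (real n + b)) sums (Digamma b - Digamma a)"
proof -
  have "(\<lambda>n. (inverse (real (Suc n)) - inverse (b + real n)) - (inverse (real (Suc n)) - inverse (a + real n)))
     sums ((Digamma b + euler_mascheroni) - (Digamma a + euler_mascheroni))"
    using summable_Digamma[of a] summable_Digamma[of b] assms
    by (intro sums_diff) (auto simp: Digamma_def sums_iff)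
  thus ?thesis by (simp add: inverse_eq_divide add_ac)
qed

text \<open>The difference of digamma values is a sum of 1 / (a - y) - 1 / (a + u - y) over positive
  integers a; both fractions are expanded as geometric series in y. The combined terms are
  nonnegative since u > 0.\<close>

lemma digamma_coeff_sums:
  fixes u y :: real
  assumes u: "0 < u" and y: "0 < y" "y < 1"
  shows "(\<lambda>m. digamma_coeff m u * y ^ m) sums (Digamma (1 + u - y) - Digamma (1 - y))"
    and "0 \<le> digamma_coeff m u"
proof -
  define f where "f = (\<lambda>n m. (1 / real (Suc n) ^ Suc m - 1 / (real (Suc n) + u) ^ Suc m) * y ^ m)"
  have geo: "(\<lambda>m. 1 / a ^ Suc m * y ^ m) sums (1 / (a - y))" if "a \<ge> 1" for a :: real
  proof -
    have "(\<lambda>m. 1 / a * (y / a) ^ m) sums (1 / a * (1 / (1 - y / a)))"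
      by (intro sums_mult geometric_sums) (use that y in auto)
    moreover have "1 / a * (1 / (1 - y / a)) = 1 / (a - y)"
      using that y by (simp add: field_simps)
    ultimately show ?thesis by (simp add: power_divide)
  qed
  have f: "f n sums (1 / (real n + (1 - y)) - 1 / (real n + (1 + u - y)))" for n
    using sums_diff[OF geo[of "real (Suc n)"] geo[of "real (Suc n) + u"]] u
    unfolding f_def by (simp add: algebra_simps)
  have le: "1 / (real (Suc n) + u) ^ Suc m \<le> 1 / real (Suc n) ^ Suc m" for n m
    using u by (intro divide_left_mono power_mono) auto
  hence nonneg: "0 \<le> f n m" for n m
    unfolding f_def using y by (intro mult_nonneg_nonneg) auto
  have S: "(\<lambda>m. suminf (\<lambda>n. f n m)) sums (Digamma (1 + u - y) - Digamma (1 - y))"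
    by (rule sums_swap_nonneg[OF nonneg f sums_inverse_shift_real]) (use u y in auto)
  have sm: "summable (\<lambda>n. 1 / real (Suc n) ^ Suc m - 1 / (real (Suc n) + u) ^ Suc m)" for m
  proof (rule summable_comparison_test)
    have "(\<lambda>n. 1 / (real n + 1) - 1 / (real n + (1 + u))) sums (Digamma (1 + u) - Digamma 1)"
      by (rule sums_inverse_shift_real) (use u in auto)
    hence "summable (\<lambda>n. 1 / (real n + 1) - 1 / (real n + (1 + u)))" by (simp add: sums_iff)
    thus "summable (\<lambda>n. real (Suc m) * (1 / (real n + 1) - 1 / (real n + (1 + u))))"
      by (rule summable_mult)
    \<comment> \<open>For m = 0 the two halves diverge separately. Factoring a - b out of a ^ (m +
      1) - b ^ (m + 1), with 0 <= b <= a <= 1, reduces every m to the difference series for m =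
      0.\<close>
    have "1 / real (Suc n) ^ Suc m - 1 / (real (Suc n) + u) ^ Suc m 
        \<le> real (Suc m) * (1 / (real n + 1) - 1 / (real n + (1 + u)))" for n
    proof -
      define a where "a = 1 / real (Suc n)"
      define b where "b = 1 / (real (Suc n) + u)"
      have ab: "0 \<le> b" "b \<le> a" "a \<le> 1" using u by (auto simp: a_def b_def field_simps)
      have "a ^ Suc m - b ^ Suc m = (a - b) * (\<Sum>i<Suc m. a ^ i * b ^ (m - i))"
        using power_diff_sumr2[of a "Suc m" b] by (simp add: mult_ac)
      also have "\<dots> \<le> (a - b) * (\<Sum>i<Suc m. 1)"
        using ab by (intro mult_left_mono sum_mono mult_le_one power_le_one zero_le_power) auto
      finally show ?thesis by (simp add: a_def b_def power_one_over add_ac mult.commute del: power_Suc)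
    qed
    thus "\<exists>N. \<forall>n\<ge>N. norm (1 / real (Suc n) ^ Suc m - 1 / (real (Suc n) + u) ^ Suc m)
        \<le> real (Suc m) * (1 / (real n + 1) - 1 / (real n + (1 + u)))"
      using le by auto
  qed
  have "suminf (\<lambda>n. f n m) = digamma_coeff m u * y ^ m" for m
    using suminf_mult2[OF sm[of m], of "y ^ m"] by (simp add: f_def digamma_coeff_def)
  with S show "(\<lambda>m. digamma_coeff m u * y ^ m) sums (Digamma (1 + u - y) - Digamma (1 - y))" by simp
  show "0 \<le> digamma_coeff m u"
    unfolding digamma_coeff_def using sm[of m] le by (intro suminf_nonneg) auto
qed

lemma gauss_coeff_nonneg: "0 < u \<Longrightarrow> 0 \<le> gauss_coeff r u"
  using summable_gauss_coeff[of u]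
  by (auto simp: gauss_coeff_def split: nat.split
      intro!: suminf_nonneg mult_nonneg_nonneg divide_nonneg_nonneg nested_harm_nonneg)

text \<open>Comparison of coefficients in \<open>F' = F * (Digamma (1 + u - y) - Digamma (1 - y))\<close> for
  \<open>F y = u * Beta u (1 - y)\<close>.\<close>

lemma gauss_coeff_rec:
  assumes u: "0 < u"
  shows "real (Suc r) * gauss_coeff (Suc r) u = (\<Sum>i\<le>r. gauss_coeff i u * digamma_coeff (r - i) u)"
proof -
  define F where "F = (\<lambda>y. u * Beta u (1 - y))"
  define D where "D = (\<lambda>y. F y * (Digamma (1 + u - y) - Digamma (1 - y)))"
  have sm: "summable (\<lambda>n. gauss_coeff n u * z ^ n)" if "norm z < 1" for z
  proof -
    obtain y where y: "norm z < y" "y < 1" using \<open>norm z < 1\<close> dense by blast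
    hence "0 < y" using norm_ge_zero[of z] by linarith
    thus ?thesis
      using powser_inside[of "\<lambda>n. gauss_coeff n u" y z] gauss_sums[of u y] y u by (auto simp: sums_iff)
  qed
  have 1: "(\<lambda>n. diffs (\<lambda>r. gauss_coeff r u) n * y ^ n) sums D y" if y: "0 < y" "y < 1" for y
  proof (rule termdiffs_sums_strong[of 1 _ "\<lambda>y. suminf (\<lambda>n. gauss_coeff n u * y ^ n)"])
    show "(\<lambda>n. gauss_coeff n u * z ^ n) sums suminf (\<lambda>n. gauss_coeff n u * z ^ n)" if "norm z < 1" for z
      using sm[OF that] by (rule summable_sums)
    have "(F has_field_derivative D y) (at y)"
      unfolding F_def Beta_def using u y
      by (auto intro!: derivative_eq_intros simp: D_def F_def Beta_def Gamma_eq_zero_iff nonpos_Ints_def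
               simp: field_simps)
    moreover have "eventually (\<lambda>z. z \<in> {0<..<1}) (nhds y)"
      using y by (intro eventually_nhds_in_open) auto
    hence "eventually (\<lambda>z. F z = suminf (\<lambda>n. gauss_coeff n u * z ^ n)) (nhds y)"
      by eventually_elim (use gauss_sums[OF u] in \<open>auto simp: F_def sums_iff\<close>)
    ultimately show "((\<lambda>y. suminf (\<lambda>n. gauss_coeff n u * y ^ n)) has_field_derivative D y) (at y)"
      by (subst (asm) DERIV_cong_ev[OF refl _ refl])
  qed (use y in auto)
  have 2: "(\<lambda>n. (\<Sum>i\<le>n. gauss_coeff i u * digamma_coeff (n - i) u) * y ^ n) sums D y"
    if y: "0 < y" "y < 1" for y
  proof -
    note A = gauss_sums[OF u y] and B = digamma_coeff_sums(1)[OF u y]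
    have "(\<lambda>n. \<Sum>i\<le>n. (gauss_coeff i u * y ^ i) * (digamma_coeff (n - i) u * y ^ (n - i))) sums
        (suminf (\<lambda>r. gauss_coeff r u * y ^ r) * suminf (\<lambda>m. digamma_coeff m u * y ^ m))"
      using A B y u gauss_coeff_nonneg[OF u] digamma_coeff_sums(2)[OF u y]
      by (intro Cauchy_product_sums) (simp_all add: sums_iff abs_mult)
    also have "suminf (\<lambda>r. gauss_coeff r u * y ^ r) * suminf (\<lambda>m. digamma_coeff m u * y ^ m) = D y"
      using A B by (simp add: sums_iff D_def F_def)
    also have "(\<lambda>n. \<Sum>i\<le>n. (gauss_coeff i u * y ^ i) * (digamma_coeff (n - i) u * y ^ (n - i))) = 
        (\<lambda>n. (\<Sum>i\<le>n. gauss_coeff i u * digamma_coeff (n - i) u) * y ^ n)"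
    proof
      fix n
      have eq: "(gauss_coeff i u * y ^ i) * (digamma_coeff (n - i) u * y ^ (n - i)) = 
          gauss_coeff i u * digamma_coeff (n - i) u * y ^ n" if "i \<le> n" for i
      proof -
        have "y ^ n = y ^ i * y ^ (n - i)" using that by (simp flip: power_add)
        thus ?thesis by simp
      qed
      show "(\<Sum>i\<le>n. (gauss_coeff i u * y ^ i) * (digamma_coeff (n - i) u * y ^ (n - i))) = 
        (\<Sum>i\<le>n. gauss_coeff i u * digamma_coeff (n - i) u) * y ^ n"
        unfolding sum_distrib_right by (intro sum.cong refl eq) auto
    qed
    finally show ?thesis .
  qed
  show ?thesis
    using powser_right_unique[OF 1 2, of r] by (simp add: diffs_def)
qed

section \<open>Expansion in the second variable u\<close>

definition gauss_taylor :: "nat \<Rightarrow> nat \<Rightarrow> real" where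
  "gauss_taylor r j = (case r of 0 \<Rightarrow> (if j = 0 then 1 else 0)
     | Suc q \<Rightarrow> (case j of 0 \<Rightarrow> 0 | Suc i \<Rightarrow> (-1) ^ i * H (Suc i) (Suc q)))"

definition digamma_taylor :: "nat \<Rightarrow> nat \<Rightarrow> real" where
  "digamma_taylor m j = (case j of 0 \<Rightarrow> 0 | Suc i \<Rightarrow> (-1) ^ i * real (m + j choose j) * mzv [m + j + 1])"

text \<open>Monotonicity in the first argument gives the u-expansions a geometric majorant with
  constant \<open>H 1 (Suc r)\<close>.\<close>

lemma H_mono:
  assumes "1 \<le> j" "j \<le> k"
  shows "0 \<le> H k (Suc r)" "H k (Suc r) \<le> H j (Suc r)"
proof -
  show "0 \<le> H k (Suc r)"
    by (rule sums_le[OF _ sums_zero H_sums]) (use assms in \<open>auto intro!: divide_nonneg_nonneg nested_harm_nonneg\<close>)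
  have "nested_harm r n / real n ^ (k + 1) \<le> nested_harm r n / real n ^ (j + 1)" for n
    using assms by (cases "n = 0") (auto intro!: divide_left_mono nested_harm_nonneg power_increasing)
  thus "H k (Suc r) \<le> H j (Suc r)"
    by (rule sums_le[OF _ H_sums H_sums]) (use assms in auto)
qed

text \<open>Expand u / (n + u) geometrically in u / n and exchange the sums; u < 1 is what the index
  n = 1 demands. The signs alternate, so the absolutely convergent version of the exchange is
  used.\<close>

lemma gauss_taylor_sums:
  fixes u :: real
  assumes u: "0 < u" "u < 1"
  shows "(\<lambda>j. gauss_taylor r j * u ^ j) sums gauss_coeff r u"
proof (cases r)
  case 0
  have "(\<lambda>j. gauss_taylor 0 j * u ^ j) sums (\<Sum>j\<in>{0}. gauss_taylor 0 j * u ^ j)"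
    by (rule sums_finite) (auto simp: gauss_taylor_def)
  thus ?thesis by (simp add: 0 gauss_taylor_def gauss_coeff_def)
next
  case (Suc q)
  define f where "f = (\<lambda>j n. (-1) ^ j * u ^ Suc j * (nested_harm q n / real n ^ (Suc j + 1)))"
  have f_sums: "(\<lambda>j. f j n) sums (nested_harm q n / real n * (u / (real n + u)))" for n
  proof (cases "n = 0")
    case False
    have "(\<lambda>j. nested_harm q n / real n * (u / n) * (- (u / n)) ^ j) sums
        (nested_harm q n / real n * (u / n) * (1 / (1 - - (u / n))))"
      using u False by (intro sums_mult geometric_sums) (auto simp: field_simps)
    also have "(\<lambda>j. nested_harm q n / real n * (u / n) * (- (u / n)) ^ j) = (\<lambda>j. f j n)"
    proof
      fix j
      have "(- (u / n)) ^ j = (-1) ^ j * (u ^ j / n ^ j)"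
        using power_mult_distrib[of "-1" "u / n" j] by (simp add: power_divide)
      thus "nested_harm q n / real n * (u / n) * (- (u / n)) ^ j = f j n"
        by (simp add: f_def mult_ac)
    qed
    also have "nested_harm q n / real n * (u / n) * (1 / (1 - - (u / n))) = nested_harm q n / real n * (u / (real n + u))"
    proof -
      have "1 / (1 - - (u / n)) = real n / (real n + u)"
        using False u by (simp add: field_simps)
      thus ?thesis using False by simp
    qed
    finally show ?thesis .
  qed (simp add: f_def)
  have "(\<lambda>n. suminf (\<lambda>j. f j n)) sums suminf (\<lambda>j. (-1) ^ j * u ^ Suc j * H (Suc j) (Suc q))"
  proof (rule sums_swap)
    show "(\<lambda>n. \<bar>f j n\<bar>) sums (u ^ Suc j * H (Suc j) (Suc q))" for j
    proof -
      have "(\<lambda>n. u ^ Suc j * (nested_harm q n / real n ^ (Suc j + 1))) sums (u ^ Suc j * H (Suc j) (Suc q))"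
        by (intro sums_mult H_sums) auto
      moreover have "\<bar>f j n\<bar> = u ^ Suc j * (nested_harm q n / real n ^ (Suc j + 1))" for n
        using u by (simp add: f_def abs_mult power_abs nested_harm_nonneg)
      ultimately show ?thesis by simp
    qed
    show "summable (\<lambda>j. u ^ Suc j * H (Suc j) (Suc q))"
    proof (rule summable_comparison_test)
      show "summable (\<lambda>j. u ^ Suc j * H 1 (Suc q))"
        using u by (intro summable_mult2) (simp add: summable_geometric summable_mult)
      show "\<exists>N. \<forall>j\<ge>N. norm (u ^ Suc j * H (Suc j) (Suc q)) \<le> u ^ Suc j * H 1 (Suc q)"
        using u H_mono[of 1 _ q] by (auto simp: abs_mult simp del: power_Suc intro!: exI[of _ 0] mult_left_mono)
    qed
    show "f j sums ((-1) ^ j * u ^ Suc j * H (Suc j) (Suc q))" for j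
      unfolding f_def by (intro sums_mult H_sums) auto
    show "(\<lambda>j. f j n) sums suminf (\<lambda>j. f j n)" for n
      using f_sums[of n] by (simp add: sums_iff)
  qed
  moreover have "suminf (\<lambda>j. f j n) = nested_harm q n / real n * (u / (real n + u))" for n
    using f_sums[of n] by (simp add: sums_iff)
  ultimately have "gauss_coeff r u = suminf (\<lambda>j. (-1) ^ j * u ^ Suc j * H (Suc j) (Suc q))"
    by (simp add: sums_iff gauss_coeff_def Suc)
  moreover have "summable (\<lambda>j. (-1) ^ j * u ^ Suc j * H (Suc j) (Suc q))"
  proof (rule summable_comparison_test)
    show "summable (\<lambda>j. u ^ Suc j * H 1 (Suc q))"
      using u by (intro summable_mult2) (simp add: summable_geometric summable_mult)
    show "\<exists>N. \<forall>j\<ge>N. norm ((-1) ^ j * u ^ Suc j * H (Suc j) (Suc q)) \<le> u ^ Suc j * H 1 (Suc q)"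
      using u H_mono[of 1 _ q] by (auto simp: abs_mult power_abs simp del: power_Suc intro!: exI[of _ 0] mult_left_mono)
  qed
  ultimately have "(\<lambda>j. (-1) ^ j * u ^ Suc j * H (Suc j) (Suc q)) sums gauss_coeff r u"
    by (simp add: sums_iff)
  hence "(\<lambda>j. gauss_taylor r (Suc j) * u ^ Suc j) sums gauss_coeff r u"
    by (simp add: gauss_taylor_def Suc mult_ac)
  thus ?thesis by (subst (asm) sums_Suc_iff) (simp add: gauss_taylor_def Suc)
qed

text \<open>Each (n + 1 + u) ^ - (m + 1) is expanded by the negative binomial series. Its constant
  term cancels 1 / (n + 1) ^ (m + 1), so only zeta values of argument m + j + 1 with j >= 1 occur,
  all of them convergent even for m = 0. They are at most \<open>mzv [2]\<close>, which gives the
  majorant.\<close>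

lemma digamma_taylor_sums:
  fixes u :: real
  assumes u: "0 < u" "u < 1"
  shows "(\<lambda>j. digamma_taylor m j * u ^ j) sums digamma_coeff m u"
proof -
  define f where "f = (\<lambda>j n. if j = 0 then 0
    else (-1) ^ (j - 1) * real (m + j choose j) * u ^ j * (1 / real (Suc n) ^ (m + j + 1)))"
  have zeta: "(\<lambda>n. 1 / real (Suc n) ^ k) sums mzv [k]" if "k \<ge> 2" for k
    using mzv_single_sums[OF that] by (subst sums_Suc_iff) (use that in \<open>simp add: power_0_left\<close>)
  have zeta_bounds: "0 \<le> mzv [k]" "mzv [k] \<le> mzv [2]" if "k \<ge> 2" for k
  proof -
    show "0 \<le> mzv [k]" by (rule sums_le[OF _ sums_zero zeta[OF that]]) auto
    show "mzv [k] \<le> mzv [2]"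
      by (rule sums_le[OF _ zeta[OF that] zeta]) (use that in \<open>auto intro!: divide_left_mono power_increasing simp del: of_nat_Suc\<close>)
  qed
  have f: "f j sums (digamma_taylor m j * u ^ j)" for j
  proof (cases j)
    case (Suc i)
    have "(\<lambda>n. (-1) ^ i * real (m + j choose j) * u ^ j * (1 / real (Suc n) ^ (m + j + 1))) sums
        ((-1) ^ i * real (m + j choose j) * u ^ j * mzv [m + j + 1])"
      by (intro sums_mult zeta) (use Suc in auto)
    thus ?thesis by (simp add: f_def digamma_taylor_def Suc mult_ac del: power_Suc binomial_Suc_Suc)
  qed (simp add: f_def digamma_taylor_def)
  define G where "G = (\<lambda>j. if j = 0 then 0 else real (m + j choose j) * u ^ j * mzv [m + j + 1])"
  have col: "(\<lambda>j. f j n) sums (1 / real (Suc n) ^ Suc m - 1 / (real (Suc n) + u) ^ Suc m)" for n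
  proof -
    define x where "x = u / real (Suc n)"
    have x: "\<bar>- x\<bar> < 1" using u by (simp add: x_def)
    have "(\<lambda>j. 1 / real (Suc n) ^ Suc m * (real (m + j choose j) * (- x) ^ j)) sums
        (1 / real (Suc n) ^ Suc m * (1 / (1 - - x) ^ Suc m))"
      by (intro sums_mult sums_binomial_negative x)
    also have "1 / real (Suc n) ^ Suc m * (1 / (1 - - x) ^ Suc m) = 1 / (real (Suc n) * (1 + x)) ^ Suc m"
      by (simp only: power_mult_distrib) simp
    also have "real (Suc n) * (1 + x) = real (Suc n) + u"
      by (simp add: x_def field_simps)
    finally have "(\<lambda>j. - (1 / real (Suc n) ^ Suc m * (real (m + Suc j choose Suc j) * (- x) ^ Suc j))) sums
        - (1 / (real (Suc n) + u) ^ Suc m - 1 / real (Suc n) ^ Suc m)"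
      by (intro sums_minus, subst sums_Suc_iff) simp
    moreover have "- (1 / real (Suc n) ^ Suc m * (real (m + Suc j choose Suc j) * (- x) ^ Suc j)) = f (Suc j) n" for j
    proof -
      have "(- x) ^ Suc j = - ((-1) ^ j * (u ^ Suc j / real (Suc n) ^ Suc j))"
        using power_mult_distrib[of "-1" x "Suc j"] by (simp add: x_def power_divide)
      thus ?thesis
        by (simp add: f_def power_add mult_ac del: binomial_Suc_Suc of_nat_Suc)
    qed
    ultimately have "(\<lambda>j. f (Suc j) n) sums - (1 / (real (Suc n) + u) ^ Suc m - 1 / real (Suc n) ^ Suc m)"
      by (simp only:)
    thus ?thesis by (subst (asm) sums_Suc_iff) (simp add: f_def)
  qed
  have bin: "summable (\<lambda>j. real (m + j choose j) * u ^ j)"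
    using sums_binomial_negative[of u m] u by (simp add: sums_iff)
  have G: "summable G"
  proof (rule summable_comparison_test)
    show "summable (\<lambda>j. real (m + j choose j) * u ^ j * mzv [2])"
      by (intro summable_mult2 bin)
    have "norm (G j) \<le> real (m + j choose j) * u ^ j * mzv [2]" for j
      using u zeta_bounds[of "m + j + 1"] zeta_bounds[of 2]
      by (auto simp: G_def abs_mult intro!: mult_left_mono)
    thus "\<exists>N. \<forall>j\<ge>N. norm (G j) \<le> real (m + j choose j) * u ^ j * mzv [2]" by blast
  qed
  have abs: "(\<lambda>n. \<bar>f j n\<bar>) sums G j" for j
  proof (cases "j = 0")
    case False
    have "(\<lambda>n. real (m + j choose j) * u ^ j * (1 / real (Suc n) ^ (m + j + 1))) sums
        (real (m + j choose j) * u ^ j * mzv [m + j + 1])"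
      by (intro sums_mult zeta) (use False in auto)
    moreover have "\<bar>f j n\<bar> = real (m + j choose j) * u ^ j * (1 / real (Suc n) ^ (m + j + 1))" for n
      using False u by (simp add: f_def abs_mult power_abs)
    ultimately show ?thesis using False by (simp add: G_def)
  qed (simp add: f_def G_def)
  have "(\<lambda>n. 1 / real (Suc n) ^ Suc m - 1 / (real (Suc n) + u) ^ Suc m) sums
      suminf (\<lambda>j. digamma_taylor m j * u ^ j)"
    by (rule sums_swap[OF abs G f col])
  hence "digamma_coeff m u = suminf (\<lambda>j. digamma_taylor m j * u ^ j)"
    by (simp add: digamma_coeff_def sums_iff)
  moreover have "summable (\<lambda>j. digamma_taylor m j * u ^ j)"
  proof (rule summable_comparison_test[OF _ G])
    have "norm (digamma_taylor m j * u ^ j) \<le> G j" for j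
      using u zeta_bounds[of "m + j + 1"]
      by (cases j) (auto simp: digamma_taylor_def G_def abs_mult power_abs mult_ac simp del: binomial_Suc_Suc power_Suc)
    thus "\<exists>N. \<forall>j\<ge>N. norm (digamma_taylor m j * u ^ j) \<le> G j" by blast
  qed
  ultimately show ?thesis by (simp add: sums_iff)
qed

text \<open>The second comparison of coefficients: both sides of \<open>gauss_coeff_rec\<close> are
  expanded in u, the right-hand side through Cauchy products. It expresses depth r + 1 through
  smaller depths and single zeta values.\<close>

lemma gauss_taylor_rec:
  "real (Suc r) * gauss_taylor (Suc r) j =
     (\<Sum>i\<le>r. \<Sum>p\<le>j. gauss_taylor i p * digamma_taylor (r - i) (j - p))"
proof -
  have summable_abs: "summable (\<lambda>n. norm (c n * u ^ n))"
    if "\<And>v. 0 < v \<Longrightarrow> v < 1 \<Longrightarrow> (\<lambda>n. c n * v ^ n) sums s v" "0 < u" "u < 1"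
    for c :: "nat \<Rightarrow> real" and s u
  proof -
    obtain v where v: "u < v" "v < 1" using \<open>u < 1\<close> dense by blast
    show ?thesis
      by (rule powser_insidea[of _ v]) (use that(1)[of v] v \<open>0 < u\<close> in \<open>auto simp: sums_iff\<close>)
  qed
  have 1: "(\<lambda>j. real (Suc r) * gauss_taylor (Suc r) j * u ^ j) sums (real (Suc r) * gauss_coeff (Suc r) u)"
    if "0 < u" "u < 1" for u
    using sums_mult[OF gauss_taylor_sums[OF that, of "Suc r"], of "real (Suc r)"] by (simp only: mult.assoc)
  have 2: "(\<lambda>j. (\<Sum>i\<le>r. \<Sum>p\<le>j. gauss_taylor i p * digamma_taylor (r - i) (j - p)) * u ^ j) sums
      (real (Suc r) * gauss_coeff (Suc r) u)"
    if u: "0 < u" "u < 1" for u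
  proof -
    have "(\<lambda>j. \<Sum>p\<le>j. (gauss_taylor i p * u ^ p) * (digamma_taylor (r - i) (j - p) * u ^ (j - p))) sums
        (gauss_coeff i u * digamma_coeff (r - i) u)" for i
      using Cauchy_product_sums[OF summable_abs[OF gauss_taylor_sums u] summable_abs[OF digamma_taylor_sums u], of i "r - i"]
        gauss_taylor_sums[OF u, of i] digamma_taylor_sums[OF u, of "r - i"]
      by (simp add: sums_iff)
    hence "(\<lambda>j. \<Sum>i\<le>r. \<Sum>p\<le>j. (gauss_taylor i p * u ^ p) * (digamma_taylor (r - i) (j - p) * u ^ (j - p))) sums
        (\<Sum>i\<le>r. gauss_coeff i u * digamma_coeff (r - i) u)"
      by (intro sums_sum) auto
    also have "(\<lambda>j. \<Sum>i\<le>r. \<Sum>p\<le>j. (gauss_taylor i p * u ^ p) * (digamma_taylor (r - i) (j - p) * u ^ (j - p))) =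
        (\<lambda>j. (\<Sum>i\<le>r. \<Sum>p\<le>j. gauss_taylor i p * digamma_taylor (r - i) (j - p)) * u ^ j)"
    proof
      fix j
      have eq: "(gauss_taylor i p * u ^ p) * (digamma_taylor (r - i) (j - p) * u ^ (j - p)) =
          gauss_taylor i p * digamma_taylor (r - i) (j - p) * u ^ j" if "p \<le> j" for i p
      proof -
        have "u ^ j = u ^ p * u ^ (j - p)" using that by (simp flip: power_add)
        thus ?thesis by simp
      qed
      show "(\<Sum>i\<le>r. \<Sum>p\<le>j. (gauss_taylor i p * u ^ p) * (digamma_taylor (r - i) (j - p) * u ^ (j - p))) =
          (\<Sum>i\<le>r. \<Sum>p\<le>j. gauss_taylor i p * digamma_taylor (r - i) (j - p)) * u ^ j"
        unfolding sum_distrib_right by (intro sum.cong refl eq) auto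
    qed
    finally show ?thesis using gauss_coeff_rec[OF u(1), of r] by simp
  qed
  show ?thesis using powser_right_unique[OF 1 2, of j] .
qed

section \<open>The algebra of zeta values\<close>

lemma
  shows rat_span_0: "0 \<in> rat_span S"
    and rat_span_add: "x \<in> rat_span S \<Longrightarrow> y \<in> rat_span S \<Longrightarrow> x + y \<in> rat_span S"
    and rat_span_scale: "x \<in> rat_span S \<Longrightarrow> of_rat c * x \<in> rat_span S"
    and rat_span_base: "x \<in> S \<Longrightarrow> x \<in> rat_span S"
proof -
  interpret Q: vector_space "\<lambda>(q::rat) (x::real). of_rat q * x" by (rule vector_space_rat_real)
  show "0 \<in> rat_span S" "x \<in> rat_span S \<Longrightarrow> y \<in> rat_span S \<Longrightarrow> x + y \<in> rat_span S"
    "x \<in> rat_span S \<Longrightarrow> of_rat c * x \<in> rat_span S" "x \<in> S \<Longrightarrow> x \<in> rat_span S"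
    unfolding rat_span_def by (auto intro: Q.span_zero Q.span_add Q.span_scale Q.span_base)
qed

lemma rat_span_induct [consumes 1, case_names base 0 add scale]:
  assumes "x \<in> rat_span S"
    and "\<And>x. x \<in> S \<Longrightarrow> P x" and "P 0"
    and "\<And>x y. P x \<Longrightarrow> P y \<Longrightarrow> P (x + y)" and "\<And>c x. P x \<Longrightarrow> P (of_rat c * x)"
  shows "P x"
proof -
  interpret Q: vector_space "\<lambda>(q::rat) (x::real). of_rat q * x" by (rule vector_space_rat_real)
  have "Q.subspace (Collect P)" using assms by (auto simp: Q.subspace_def)
  thus ?thesis using Q.span_induct[of x S P] assms(1,2) unfolding rat_span_def by auto
qed

lemma zeta_products_mult:
  assumes "x \<in> zeta_products" "y \<in> zeta_products"
  shows "x * y \<in> zeta_products"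
proof -
  from assms obtain ks ls where "x = (\<Prod>k\<leftarrow>ks. mzv [k])" "y = (\<Prod>k\<leftarrow>ls. mzv [k])"
    "\<forall>k\<in>set ks. 2 \<le> k" "\<forall>k\<in>set ls. 2 \<le> k"
    unfolding zeta_products_def by blast
  thus ?thesis unfolding zeta_products_def by (auto intro!: exI[of _ "ks @ ls"])
qed

text \<open>Products of zeta values are closed under multiplication, and bilinearity carries this to
  the span, making it a ring in which the recursion can be run.\<close>

lemma rat_span_zeta_mult:
  assumes "x \<in> rat_span zeta_products" "y \<in> rat_span zeta_products"
  shows "x * y \<in> rat_span zeta_products"
  using assms(1)
proof (induction rule: rat_span_induct)
  case (base x)
  from assms(2) show ?case
  proof (induction rule: rat_span_induct)
    case (base y)
    thus ?case using \<open>x \<in> zeta_products\<close> by (intro rat_span_base zeta_products_mult)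
  next
    case (scale c y)
    thus ?case using rat_span_scale[of "x * y" zeta_products c] by (simp add: mult_ac)
  qed (auto simp: distrib_left intro: rat_span_0 rat_span_add)
next
  case (scale c x)
  thus ?case using rat_span_scale[of "x * y" zeta_products c] by (simp add: mult_ac)
qed (auto simp: distrib_right intro: rat_span_0 rat_span_add)

lemma rat_span_zeta_of_rat: "of_rat q \<in> rat_span zeta_products"
proof -
  have "1 \<in> zeta_products" unfolding zeta_products_def by (auto intro!: exI[of _ "[]"])
  from rat_span_scale[OF rat_span_base[OF this], of q] show ?thesis by simp
qed

lemma rat_span_zeta_rat: "x \<in> \<rat> \<Longrightarrow> x \<in> rat_span zeta_products"
  using rat_span_zeta_of_rat by (auto elim!: Rats_cases)

lemma rat_span_zeta_power: "x \<in> rat_span zeta_products \<Longrightarrow> x ^ n \<in> rat_span zeta_products"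
  by (induction n) (auto intro: rat_span_zeta_mult rat_span_zeta_rat)

lemma rat_span_sum: "(\<And>i. i \<in> A \<Longrightarrow> f i \<in> rat_span S) \<Longrightarrow> sum f A \<in> rat_span S"
  by (induction A rule: infinite_finite_induct) (auto intro: rat_span_0 rat_span_add)

lemma mzv_single_in_rat_span: "k \<ge> 2 \<Longrightarrow> mzv [k] \<in> rat_span zeta_products"
  by (rule rat_span_base) (auto simp: zeta_products_def intro!: exI[of _ "[k]"])

lemma gauss_taylor_in_rat_span: "gauss_taylor r j \<in> rat_span zeta_products"
proof (induction r arbitrary: j rule: less_induct)
  case (less r)
  show ?case
  proof (cases r)
    case 0
    thus ?thesis by (auto simp: gauss_taylor_def intro!: rat_span_zeta_rat)
  next
    case (Suc q)
    have dig: "digamma_taylor m i \<in> rat_span zeta_products" for m i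
    proof (cases i)
      case (Suc p)
      have "(-1) ^ p * real (m + i choose i) * mzv [m + i + 1] \<in> rat_span zeta_products"
        by (rule rat_span_zeta_mult[OF rat_span_zeta_rat mzv_single_in_rat_span]) (use Suc in auto)
      thus ?thesis by (simp add: digamma_taylor_def Suc)
    qed (simp add: digamma_taylor_def rat_span_0)
    have "gauss_taylor r j = 1 / real (Suc q) * (real (Suc q) * gauss_taylor (Suc q) j)"
      using Suc by simp
    also have "\<dots> \<in> rat_span zeta_products"
      unfolding gauss_taylor_rec
      by (intro rat_span_zeta_mult rat_span_sum dig less) (use Suc in \<open>auto intro!: rat_span_zeta_rat\<close>)
    finally show ?thesis .
  qed
qed

lemma H_in_rat_span:
  assumes "1 \<le> k" "1 \<le> r"
  shows "H k r \<in> rat_span zeta_products"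
proof -
  obtain i q where "k = Suc i" "r = Suc q" using assms by (metis Suc_le_D One_nat_def)
  hence "H k r = (-1) ^ i * gauss_taylor r k"
    by (simp add: gauss_taylor_def flip: power_add mult.assoc)
  moreover have "(-1) ^ i * gauss_taylor r k \<in> rat_span zeta_products"
    by (rule rat_span_zeta_mult[OF rat_span_zeta_rat gauss_taylor_in_rat_span]) auto
  ultimately show ?thesis by simp
qed

section \<open>The Green function on the imaginary axis\<close>

definition logterm :: "real \<Rightarrow> real \<Rightarrow> real" where
  "logterm T s = - ln (1 - exp (- (2 * T * s)))"

lemma logterm_nonneg: "0 < T \<Longrightarrow> 0 < s \<Longrightarrow> 0 \<le> logterm T s"
  by (simp add: logterm_def)

text \<open>The value depends only on T * s. Allowing both parameters to vary gives in one statement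
  the comparison with T = 1 and the comparison between different points.\<close>

lemma logterm_mono:
  assumes "0 < T" "0 < s" "T * s \<le> T' * s'"
  shows "logterm T' s' \<le> logterm T s"
proof -
  have "0 < T * s" using assms by simp
  moreover from this have "0 < T' * s'" using assms(3) by linarith
  ultimately
  have "ln (1 - exp (- (2 * T * s))) \<le> ln (1 - exp (- (2 * T' * s')))"
    using assms by (subst ln_le_cancel_iff) auto
  thus ?thesis by (simp add: logterm_def)
qed

text \<open>The factor \<open>1 + logterm T s\<close> absorbs the logarithmic singularity at \<open>s = 0\<close>.\<close>

lemma logterm_le:
  assumes "0 < T" "0 < s"
  shows "logterm T s \<le> exp (- (2 * T * s)) * (1 + logterm T s)"
proof -
  define v where "v = 1 - exp (- (2 * T * s))"
  have v: "0 < v" "v < 1" using assms by (auto simp: v_def)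
  \<comment> \<open>With x = exp (- (2 * T * s)) and L = \<open>logterm T s\<close>, multiplying by
    v = 1 - x gives (1 - x) L <= x, which rearranges to the claim.\<close>
  have "ln (1 / v) \<le> 1 / v - 1"
    using v by (intro ln_le_minus_one) auto
  hence "v * (- ln v) \<le> v * (1 / v - 1)"
    using v by (intro mult_left_mono) (auto simp: ln_div)
  hence "- (v * ln v) \<le> 1 - v"
    using v by (simp add: right_diff_distrib)
  moreover have "exp (- (2 * T * s)) = 1 - v" "logterm T s = - ln v"
    by (simp_all add: v_def logterm_def)
  ultimately show ?thesis by (simp only:) (simp add: algebra_simps)
qed

text \<open>The exponential decay keeps its dependence on T while the singular factor is frozen at T
  = 1; this separation yields dominating functions uniform in T.\<close>

lemma logterm_le_exp:
  assumes "1 \<le> T" "0 < s"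
  shows "logterm T s \<le> exp (- (2 * T * s)) * (1 + logterm 1 s)"
proof -
  have "logterm T s \<le> logterm 1 s"
    using assms by (intro logterm_mono) auto
  hence "exp (- (2 * T * s)) * (1 + logterm T s) \<le> exp (- (2 * T * s)) * (1 + logterm 1 s)"
    by (intro mult_left_mono) auto
  thus ?thesis using logterm_le[of T s] assms by linarith
qed

lemma logterm_measurable [measurable]: "logterm T \<in> borel_measurable borel"
  unfolding logterm_def by measurable

lemma summable_logterm:
  assumes "0 < T" "0 < a"
  shows "summable (\<lambda>n. logterm T (real n + a))"
proof (rule summable_comparison_test)
  have "summable (\<lambda>n. exp (- (2 * T)) ^ n)"
    using assms by (intro summable_geometric) auto
  thus "summable (\<lambda>n. (1 + logterm T a) * exp (- (2 * T)) ^ n)"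
    by (intro summable_mult)
  have "norm (logterm T (real n + a)) \<le> (1 + logterm T a) * exp (- (2 * T)) ^ n" for n
  proof -
    have "logterm T (real n + a) \<le> exp (- (2 * T * (real n + a))) * (1 + logterm T (real n + a))"
      using assms by (intro logterm_le) auto
    also have "\<dots> \<le> exp (- (2 * T) * real n) * (1 + logterm T a)"
      using assms by (intro mult_mono add_left_mono logterm_mono add_nonneg_nonneg logterm_nonneg)
        (auto simp: algebra_simps)
    also have "exp (- (2 * T) * real n) = exp (- (2 * T)) ^ n"
      by (simp add: exp_of_nat_mult[symmetric] mult.commute)
    finally show ?thesis using logterm_nonneg[of T "real n + a"] assms by (simp add: mult.commute)
  qed
  thus "\<exists>N. \<forall>n\<ge>N. norm (logterm T (real n + a)) \<le> (1 + logterm T a) * exp (- (2 * T)) ^ n" by blast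
qed

section \<open>Moments of powers of the logarithmic term\<close>

lemma nn_integral_power_exp:
  assumes "0 < c"
  shows "(\<integral>\<^sup>+t. ennreal (indicator {0<..} t * (t ^ k * exp (- (c * t)))) \<partial>lborel) = ennreal (fact k / c ^ Suc k)"
proof -
  have "ennreal (fact k) = (\<integral>\<^sup>+t. ennreal (t ^ k * exp (- t)) * indicator {0..} t \<partial>lborel)"
    using nn_intergal_power_times_exp_Ici[of k] by simp
  also have "\<dots> = ennreal c * (\<integral>\<^sup>+t. ennreal ((0 + c * t) ^ k * exp (- (0 + c * t))) * indicator {0..} (0 + c * t) \<partial>lborel)"
    using assms by (subst nn_integral_real_affine[where c = c and t = 0]) auto
  also have "(\<integral>\<^sup>+t. ennreal ((0 + c * t) ^ k * exp (- (0 + c * t))) * indicator {0..} (0 + c * t) \<partial>lborel) = 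
      (\<integral>\<^sup>+t. ennreal (c ^ k) * ennreal (indicator {0<..} t * (t ^ k * exp (- (c * t)))) \<partial>lborel)"
  proof (rule nn_integral_cong_AE, use AE_lborel_singleton[of 0] in eventually_elim)
    fix t :: real assume "t \<noteq> 0"
    thus "ennreal ((0 + c * t) ^ k * exp (- (0 + c * t))) * indicator {0..} (0 + c * t) = 
        ennreal (c ^ k) * ennreal (indicator {0<..} t * (t ^ k * exp (- (c * t))))"
      using assms by (auto simp: indicator_def power_mult_distrib zero_le_mult_iff ennreal_mult'[symmetric] mult_ac)
  qed
  also have "\<dots> = ennreal (c ^ k) * (\<integral>\<^sup>+t. ennreal (indicator {0<..} t * (t ^ k * exp (- (c * t)))) \<partial>lborel)"
    by (rule nn_integral_cmult) auto
  finally have *: "ennreal (c ^ Suc k) * (\<integral>\<^sup>+t. ennreal (indicator {0<..} t * (t ^ k * exp (- (c * t)))) \<partial>lborel) = ennreal (fact k)"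
    using assms by (simp add: ennreal_mult mult.assoc)
  have "ennreal (fact k / c ^ Suc k) = ennreal (1 / c ^ Suc k) * ennreal (fact k)"
    using assms by (subst ennreal_mult[symmetric]) auto
  also have "\<dots> = ennreal (1 / c ^ Suc k) * ennreal (c ^ Suc k) * (\<integral>\<^sup>+t. ennreal (indicator {0<..} t * (t ^ k * exp (- (c * t)))) \<partial>lborel)"
    by (simp only: * mult.assoc)
  also have "ennreal (1 / c ^ Suc k) * ennreal (c ^ Suc k) = 1"
    using assms by (subst ennreal_mult[symmetric]) auto
  finally show ?thesis by simp
qed

text \<open>Expand the power of the logarithm by \<open>sums_log_power\<close> at x = exp (- (2 * T
  * t)) and integrate term by term. The Gamma integral contributes k! / (2 T n) ^ (k + 1), and the
  further 1 / n of the expansion completes the exponent k + 2 that defines H (k + 1).\<close>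

lemma nn_integral_power_logterm:
  assumes T: "0 < T"
  shows "(\<integral>\<^sup>+t. ennreal (indicator {0<..} t * (t ^ k * logterm T t ^ Suc r)) \<partial>lborel) = 
    ennreal (fact (Suc r) * fact k / (2 * T) ^ Suc k * H (Suc k) (Suc r))"
proof -
  define a where "a = (\<lambda>n. fact (Suc r) * (nested_harm r n / real n))"
  have a: "0 \<le> a n" for n by (simp add: a_def nested_harm_nonneg)
  define f where "f = (\<lambda>n t. a n * (indicator {0<..} t * (t ^ k * exp (- (2 * T * real n * t)))))"
  have f_nonneg: "0 \<le> f n t" for n t
    unfolding f_def using a by (auto simp: indicator_def intro!: mult_nonneg_nonneg)
  have "(\<integral>\<^sup>+t. ennreal (indicator {0<..} t * (t ^ k * logterm T t ^ Suc r)) \<partial>lborel) =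
      (\<integral>\<^sup>+t. suminf (\<lambda>n. ennreal (f n t)) \<partial>lborel)"
  proof (rule nn_integral_cong)
    fix t :: real
    show "ennreal (indicator {0<..} t * (t ^ k * logterm T t ^ Suc r)) = suminf (\<lambda>n. ennreal (f n t))"
    proof (cases "t > 0")
      case True
      define x where "x = exp (- (2 * T * t))"
      have "(\<lambda>n. nested_harm r n / real n * x ^ n) sums ((- ln (1 - x)) ^ Suc r / fact (Suc r))"
        by (rule sums_log_power) (use True T in \<open>auto simp: x_def\<close>)
      from sums_mult[OF this, of "t ^ k * fact (Suc r)"]
      have "(\<lambda>n. t ^ k * fact (Suc r) * (nested_harm r n / real n * x ^ n)) sums (t ^ k * logterm T t ^ Suc r)"
        by (simp add: logterm_def x_def del: fact_Suc power_Suc)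
      also have "(\<lambda>n. t ^ k * fact (Suc r) * (nested_harm r n / real n * x ^ n)) = (\<lambda>n. f n t)"
        using True by (simp add: f_def a_def x_def fun_eq_iff exp_of_nat_mult[symmetric] mult_ac del: fact_Suc)
      finally have "(\<lambda>n. ennreal (f n t)) sums ennreal (t ^ k * logterm T t ^ Suc r)"
        using f_nonneg True T by (subst sums_ennreal) (auto intro!: mult_nonneg_nonneg zero_le_power logterm_nonneg)
      thus ?thesis using True by (simp add: sums_iff)
    qed (simp add: f_def)
  qed
  also have "\<dots> = suminf (\<lambda>n. \<integral>\<^sup>+t. ennreal (f n t) \<partial>lborel)"
    by (rule nn_integral_suminf) (simp add: f_def)
  also have "(\<lambda>n. \<integral>\<^sup>+t. ennreal (f n t) \<partial>lborel) = 
      (\<lambda>n. ennreal (fact (Suc r) * fact k / (2 * T) ^ Suc k * (nested_harm r n / real n ^ (Suc k + 1))))"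
  proof
    fix n
    show "(\<integral>\<^sup>+t. ennreal (f n t) \<partial>lborel) = 
      ennreal (fact (Suc r) * fact k / (2 * T) ^ Suc k * (nested_harm r n / real n ^ (Suc k + 1)))"
    proof (cases "n = 0")
      case False
      have "(\<integral>\<^sup>+t. ennreal (f n t) \<partial>lborel) = 
          (\<integral>\<^sup>+t. ennreal (a n) * ennreal (indicator {0<..} t * (t ^ k * exp (- (2 * T * real n * t)))) \<partial>lborel)"
        unfolding f_def using a by (intro nn_integral_cong ennreal_mult) (auto simp: indicator_def)
      also have "\<dots> = ennreal (a n) * (\<integral>\<^sup>+t. ennreal (indicator {0<..} t * (t ^ k * exp (- (2 * T * real n * t)))) \<partial>lborel)"
        by (rule nn_integral_cmult) auto
      also have "\<dots> = ennreal (a n) * ennreal (fact k / (2 * T * real n) ^ Suc k)"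
        using False T by (subst nn_integral_power_exp) auto
      also have "\<dots> = ennreal (a n * (fact k / (2 * T * real n) ^ Suc k))"
        using a T by (intro ennreal_mult[symmetric]) auto
      also have "a n * (fact k / (2 * T * real n) ^ Suc k) = 
          fact (Suc r) * fact k / (2 * T) ^ Suc k * (nested_harm r n / real n ^ (Suc k + 1))"
        using False T by (simp add: a_def power_mult_distrib field_simps del: fact_Suc)
      finally show ?thesis .
    qed (simp add: f_def a_def)
  qed
  also have "suminf \<dots> = ennreal (fact (Suc r) * fact k / (2 * T) ^ Suc k * H (Suc k) (Suc r))"
  proof -
    have "(\<lambda>n. fact (Suc r) * fact k / (2 * T) ^ Suc k * (nested_harm r n / real n ^ (Suc k + 1))) sums
        (fact (Suc r) * fact k / (2 * T) ^ Suc k * H (Suc k) (Suc r))"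
      by (intro sums_mult H_sums) auto
    moreover have nonneg: "0 \<le> fact (Suc r) * fact k / (2 * T) ^ Suc k * (nested_harm r n / real n ^ (Suc k + 1))" for n
      using T by (intro mult_nonneg_nonneg divide_nonneg_nonneg nested_harm_nonneg) auto
    moreover have "0 \<le> fact (Suc r) * fact k / (2 * T) ^ Suc k * H (Suc k) (Suc r)"
      using sums_le[OF nonneg sums_zero calculation(1)] .
    ultimately have "(\<lambda>n. ennreal (fact (Suc r) * fact k / (2 * T) ^ Suc k * (nested_harm r n / real n ^ (Suc k + 1)))) sums
        ennreal (fact (Suc r) * fact k / (2 * T) ^ Suc k * H (Suc k) (Suc r))"
      by (subst sums_ennreal)
    thus ?thesis by (simp only: sums_iff)
  qed
  finally show ?thesis .
qed

lemma power_logterm_integral: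
  assumes T: "0 < T"
  shows "set_integrable lborel {0<..} (\<lambda>t. t ^ k * logterm T t ^ Suc r)"
    and "(LINT t:{0<..}|lborel. t ^ k * logterm T t ^ Suc r) = 
           fact (Suc r) * fact k / (2 * T) ^ Suc k * H (Suc k) (Suc r)"
proof -
  have nonneg: "0 \<le> indicator {0<..} t * (t ^ k * logterm T t ^ Suc r)" for t
    using T by (cases "t > 0") (auto intro!: mult_nonneg_nonneg zero_le_power logterm_nonneg)
  have meas: "(\<lambda>t. indicator {0<..} t * (t ^ k * logterm T t ^ Suc r)) \<in> borel_measurable lborel"
    by measurable
  show "set_integrable lborel {0<..} (\<lambda>t. t ^ k * logterm T t ^ Suc r)"
    unfolding set_integrable_def real_scaleR_def
    by (rule integrableI_nn_integral_finite[OF meas _ nn_integral_power_logterm[OF T]]) (use nonneg in auto)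
  have "0 \<le> H (Suc k) (Suc r)"
    by (rule sums_le[OF _ sums_zero H_sums]) (auto intro!: divide_nonneg_nonneg nested_harm_nonneg)
  thus "(LINT t:{0<..}|lborel. t ^ k * logterm T t ^ Suc r) = 
           fact (Suc r) * fact k / (2 * T) ^ Suc k * H (Suc k) (Suc r)"
    unfolding set_lebesgue_integral_def real_scaleR_def
    using nonneg T by (subst integral_eq_nn_integral[OF meas]) (auto simp: nn_integral_power_logterm[OF T] simp del: fact_Suc power_Suc)
qed

text \<open>These are the theta factors with exponents n + t for n >= 1 and n - t for n >= 2, which
  stay away from 1 on the unit interval. The factor with exponent 1 - t is kept apart because its
  logarithm is singular at t = 1.\<close>

definition remainder :: "real \<Rightarrow> real \<Rightarrow> real" where
  "remainder T t = suminf (\<lambda>n. logterm T (real n + 1 + t) + logterm T (real n + 2 - t))"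

text \<open>This is T times the second Bernoulli polynomial, minus zeta(2) / T.\<close>

definition quadratic :: "real \<Rightarrow> real \<Rightarrow> real" where
  "quadratic T t = T * (t\<^sup>2 - t + 1/6) - pi\<^sup>2 / (6 * T)"

definition potential :: "real \<Rightarrow> real \<Rightarrow> real" where
  "potential T t = quadratic T t + logterm T t + logterm T (1 - t) + remainder T t"

lemma prodinf_exp_of_real:
  assumes "f sums s"
  shows "prodinf (\<lambda>n. complex_of_real (exp (- f n))) = of_real (exp (- s))"
proof -
  have "(\<lambda>n. exp (- f n)) has_prod exp (- s)"
    unfolding has_prod_def using sums_imp_has_prod_exp[OF sums_minus[OF assms]] by simp
  hence "(\<lambda>n. complex_of_real (exp (- f n))) has_prod of_real (exp (- s))"
    by (simp only: has_prod_of_real_iff)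
  thus ?thesis by (simp add: has_prod_iff)
qed

text \<open>On the imaginary axis q is real, so every product factor is the exponential of minus a
  \<open>logterm\<close>. The factors 1 - q ^ n of theta and eta cancel, the prefactors leave q ^
  (1/12) = exp (- T / 6), and the sine supplies exp (T t) together with
  \<open>logterm T t\<close>.\<close>

lemma P_B_eq:
  assumes T: "0 < T" and t: "0 < t" "t < 1"
  defines "\<tau> \<equiv> \<i> * complex_of_real T / complex_of_real pi"
  shows "P_B (of_real t * \<tau>) \<tau> = of_real (potential T t)"
proof -
  have q: "qpow \<tau> r = of_real (exp (- (2 * T * r)))" for r
  proof -
    have "2 * of_real pi * \<i> * \<tau> * of_real r = complex_of_real (- (2 * T * r))"
      by (simp add: \<tau>_def field_simps)
    thus ?thesis by (simp only: qpow_def exp_of_real)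
  qed
  have qn: "qpow \<tau> 1 ^ Suc n = of_real (exp (- (2 * T * real (Suc n))))" for n
    by (simp only: q of_real_power[symmetric] exp_of_nat_mult[symmetric]) (simp add: algebra_simps)
  have z: "exp (2 * of_real pi * \<i> * (of_real t * \<tau>)) = of_real (exp (- (2 * T * t)))"
    "exp (- 2 * of_real pi * \<i> * (of_real t * \<tau>)) = of_real (exp (2 * T * t))"
  proof -
    have "2 * of_real pi * \<i> * (of_real t * \<tau>) = complex_of_real (- (2 * T * t))"
       "- 2 * of_real pi * \<i> * (of_real t * \<tau>) = complex_of_real (2 * T * t)"
      by (simp_all add: \<tau>_def field_simps)
    thus "exp (2 * of_real pi * \<i> * (of_real t * \<tau>)) = of_real (exp (- (2 * T * t)))"
      "exp (- 2 * of_real pi * \<i> * (of_real t * \<tau>)) = of_real (exp (2 * T * t))"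
      by (simp_all only: exp_of_real)
  qed
  have E: "1 - exp (- (2 * T * s)) = exp (- logterm T s)" if "s > 0" for s
    using that T by (simp add: logterm_def)
  define S0 where "S0 = suminf (\<lambda>n. logterm T (real n + 1))"
  define Sp where "Sp = suminf (\<lambda>n. logterm T (real n + (1 + t)))"
  define Sm where "Sm = suminf (\<lambda>n. logterm T (real n + (1 - t)))"
  have sums: "(\<lambda>n. logterm T (real n + 1)) sums S0" "(\<lambda>n. logterm T (real n + (1 + t))) sums Sp"
    "(\<lambda>n. logterm T (real n + (1 - t))) sums Sm"
    unfolding S0_def Sp_def Sm_def by (intro summable_sums summable_logterm; use T t in simp)+
  have eta: "dedekind_eta \<tau> = of_real (exp (- (T / 12)) * exp (- S0))"
  proof -
    have "1 - qpow \<tau> 1 ^ Suc n = of_real (exp (- logterm T (real n + 1)))" for n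
      by (simp only: qn) (simp flip: E add: add_ac)
    thus ?thesis unfolding dedekind_eta_def using prodinf_exp_of_real[OF sums(1)] by (simp add: q)
  qed
  have "(1 - qpow \<tau> 1 ^ Suc n) * (1 - qpow \<tau> 1 ^ Suc n * exp (2 * of_real pi * \<i> * (of_real t * \<tau>)))
         * (1 - qpow \<tau> 1 ^ Suc n * exp (- 2 * of_real pi * \<i> * (of_real t * \<tau>))) = 
      of_real (exp (- (logterm T (real n + 1) + logterm T (real n + (1 + t)) + logterm T (real n + (1 - t)))))" for n
  proof -
    have "exp (- (2 * T * real (Suc n))) * exp (- (2 * T * t)) = exp (- (2 * T * (real n + (1 + t))))"
      "exp (- (2 * T * real (Suc n))) * exp (2 * T * t) = exp (- (2 * T * (real n + (1 - t))))"
      by (simp_all add: algebra_simps flip: exp_add)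
    hence "(1 - exp (- (2 * T * real (Suc n)))) * (1 - exp (- (2 * T * real (Suc n))) * exp (- (2 * T * t)))
         * (1 - exp (- (2 * T * real (Suc n))) * exp (2 * T * t)) = 
       exp (- (logterm T (real n + 1) + logterm T (real n + (1 + t)) + logterm T (real n + (1 - t))))"
      using t E[of "real n + 1"] E[of "real n + (1 + t)"] E[of "real n + (1 - t)"]
      by (simp only: minus_add_distrib exp_add) (simp add: add.commute)
    from arg_cong[OF this, of complex_of_real] show ?thesis unfolding qn z
      by (simp only: of_real_mult of_real_diff of_real_1)
  qed
  hence "theta1 (of_real t * \<tau>) \<tau> = 2 * of_real (exp (- (T / 4))) * sin (of_real pi * (of_real t * \<tau>))
      * of_real (exp (- (S0 + Sp + Sm)))"
    unfolding theta1_def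
    using prodinf_exp_of_real[OF sums_add[OF sums_add[OF sums(1,2)] sums(3)]] by (simp add: q)
  also have "sin (of_real pi * (of_real t * \<tau>)) = \<i> * of_real ((exp (T * t) - exp (- (T * t))) / 2)"
  proof -
    have "of_real pi * (of_real t * \<tau>) = \<i> * complex_of_real (T * t)" by (simp add: \<tau>_def)
    thus ?thesis by (simp only: sin_i_times exp_of_real exp_minus of_real_inverse of_real_diff of_real_divide of_real_numeral)
  qed
  finally have "norm (theta1 (of_real t * \<tau>) \<tau> / dedekind_eta \<tau>) = 
     exp (- (T / 4)) * \<bar>exp (T * t) - exp (- (T * t))\<bar> * exp (- (S0 + Sp + Sm)) / (exp (- (T / 12)) * exp (- S0))"
    unfolding eta by (simp add: norm_mult norm_divide del: of_real_exp of_real_diff of_real_mult)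
  also have "exp (T * t) - exp (- (T * t)) = exp (T * t) * (1 - exp (- (2 * T * t)))"
    by (simp add: algebra_simps flip: exp_add)
  also have "\<dots> = exp (T * t) * exp (- logterm T t)"
    using E t by simp
  also have "exp (- (T / 4)) * \<bar>exp (T * t) * exp (- logterm T t)\<bar> * exp (- (S0 + Sp + Sm)) / (exp (- (T / 12)) * exp (- S0))
    = exp (- T / 6 + T * t - logterm T t - Sp - Sm)"
    by (simp add: abs_mult field_simps flip: exp_add)
  finally have L: "ln (norm (theta1 (of_real t * \<tau>) \<tau> / dedekind_eta \<tau>)) = - T / 6 + T * t - logterm T t - Sp - Sm"
    by simp
  have S: "Sp + Sm = logterm T (1 - t) + remainder T t"
  proof -
    \<comment> \<open>Splitting off n = 0 isolates \<open>logterm T (1 - t)\<close>; the shifted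
      series is the second half of \<open>remainder\<close>.\<close>
    have "(\<lambda>n. logterm T (real (Suc n) + (1 - t))) sums (Sm - logterm T (1 - t))"
      using sums(3) by (subst sums_Suc_iff) simp
    from sums_add[OF sums(2) this] show ?thesis
      unfolding remainder_def by (simp add: sums_iff algebra_simps)
  qed
  have Q: "\<i> * of_real pi / \<tau> * ((of_real t * \<tau>)\<^sup>2 + 1/6) = of_real (- (T * t\<^sup>2) + pi\<^sup>2 / (6 * T))"
    using T by (simp add: \<tau>_def field_simps power2_eq_square)
  show ?thesis
    unfolding P_B_def L Q potential_def quadratic_def using S
    by (simp only: of_real_minus[symmetric] of_real_diff[symmetric] of_real_eq_iff) (simp add: algebra_simps)
qed

section \<open>Asymptotics of the integral\<close>

text \<open>In divided powers x ^ n / n! the binomial theorem is a plain convolution, so iterating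
  it gives the multinomial theorem without multinomial coefficients.\<close>

lemma divided_power_add:
  fixes x y :: real
  shows "(x + y) ^ n / fact n = (\<Sum>i\<le>n. x ^ i / fact i * (y ^ (n - i) / fact (n - i)))"
  using exp_series_add_commuting[of x y n] by (simp add: scaleR_conv_of_real divide_inverse mult_ac)

abbreviation compositions4 :: "nat \<Rightarrow> (nat \<times> nat \<times> nat \<times> nat) set" where
  "compositions4 l \<equiv> {(a, b, c, d). a + b + c + d = l}"

abbreviation compositions5 :: "nat \<Rightarrow> (nat \<times> nat \<times> nat \<times> nat \<times> nat) set" where
  "compositions5 l \<equiv> {(a, b, c, d, e). a + b + c + d + e = l}"

lemma finite_compositions4: "finite (compositions4 l)"
  by (rule finite_subset[of _ "{..l} \<times> {..l} \<times> {..l} \<times> {..l}"]) auto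

lemma finite_compositions5: "finite (compositions5 l)"
  by (rule finite_subset[of _ "{..l} \<times> {..l} \<times> {..l} \<times> {..l} \<times> {..l}"]) auto

lemma divided_power_add3:
  fixes x y z :: real
  shows "(x + (y + z)) ^ n / fact n = 
    (\<Sum>(a, b, c)\<in>{(a, b, c). a + b + c = n}. x ^ a / fact a * (y ^ b / fact b * (z ^ c / fact c)))"
proof -
  have *: "{(a, b, c). a + b + c = n} = (SIGMA a:{..n}. SIGMA b:{..n - a}. {n - a - b})" by auto
  show ?thesis
    unfolding * divided_power_add by (simp add: sum.Sigma[symmetric] sum_distrib_left)
qed

lemma divided_power_add4:
  fixes x y z w :: real
  shows "(x + (y + (z + w))) ^ n / fact n = 
    (\<Sum>(a, b, c, d)\<in>compositions4 n. x ^ a / fact a * (y ^ b / fact b * (z ^ c / fact c * (w ^ d / fact d))))"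
proof -
  have *: "compositions4 n = (SIGMA a:{..n}. {(b, c, d). b + c + d = n - a})" by auto
  have "finite {(b, c, d). b + c + d = m}" for m :: nat
    by (rule finite_subset[of _ "{..m} \<times> {..m} \<times> {..m}"]) auto
  hence "(\<Sum>(a, b, c, d)\<in>compositions4 n. x ^ a / fact a * (y ^ b / fact b * (z ^ c / fact c * (w ^ d / fact d)))) =
     (\<Sum>a\<le>n. x ^ a / fact a * ((y + (z + w)) ^ (n - a) / fact (n - a)))"
    unfolding * divided_power_add3
    by (subst sum.Sigma[symmetric]) (auto simp: sum_distrib_left case_prod_unfold)
  thus ?thesis by (simp only: divided_power_add[of x])
qed

lemma divided_power_add5:
  fixes x y z w v :: real
  shows "(x + (y + (z + (w + v)))) ^ n / fact n = 
    (\<Sum>(a, b, c, d, e)\<in>compositions5 n. 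
       x ^ a / fact a * (y ^ b / fact b * (z ^ c / fact c * (w ^ d / fact d * (v ^ e / fact e)))))"
proof -
  have *: "compositions5 n = (SIGMA a:{..n}. compositions4 (n - a))" by auto
  have "(\<Sum>(a, b, c, d, e)\<in>compositions5 n. 
       x ^ a / fact a * (y ^ b / fact b * (z ^ c / fact c * (w ^ d / fact d * (v ^ e / fact e))))) =
     (\<Sum>a\<le>n. x ^ a / fact a * ((y + (z + (w + v))) ^ (n - a) / fact (n - a)))"
    unfolding * divided_power_add4 using finite_compositions4
    by (subst sum.Sigma[symmetric]) (auto simp: sum_distrib_left case_prod_unfold)
  thus ?thesis by (simp only: divided_power_add[of x])
qed

text \<open>The t-free part of a multinomial term of \<open>quadratic\<close>, with summands T t ^
  2, - T t, T / 6 and - pi ^ 2 / (6 T) taken in divided powers.\<close>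

definition quad_weight :: "real \<Rightarrow> nat \<Rightarrow> nat \<Rightarrow> nat \<Rightarrow> nat \<Rightarrow> real" where
  "quad_weight T a b c d = 
    T ^ a / fact a * ((- T) ^ b / fact b * ((T / 6) ^ c / fact c * ((- (pi\<^sup>2 / (6 * T))) ^ d / fact d)))"

lemma quadratic_power:
  "quadratic T t ^ l = (\<Sum>(a, b, c, d)\<in>compositions4 l. fact l * quad_weight T a b c d * t ^ (2 * a + b))"
proof -
  have "quadratic T t = T * t\<^sup>2 + (- T * t + (T / 6 + - (pi\<^sup>2 / (6 * T))))"
    by (simp add: quadratic_def algebra_simps)
  hence "quadratic T t ^ l = fact l * ((T * t\<^sup>2 + (- T * t + (T / 6 + - (pi\<^sup>2 / (6 * T))))) ^ l / fact l)"
    by simp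
  also have "\<dots> = (\<Sum>(a, b, c, d)\<in>compositions4 l. fact l * quad_weight T a b c d * t ^ (2 * a + b))"
    unfolding divided_power_add4 sum_distrib_left
    by (intro sum.cong refl, simp only: quad_weight_def power_mult_distrib power_add power_mult case_prod_unfold)
       (simp only: times_divide_eq_left times_divide_eq_right divide_divide_eq_left mult_ac)
  finally show ?thesis .
qed

text \<open>X enters as a fifth multinomial summand; the terms with e = 0 reassemble
  \<open>quadratic T t ^ l\<close>, which leaves e >= 1.\<close>

lemma excess_power:
  "(quadratic T t + X) ^ l - quadratic T t ^ l = 
    (\<Sum>(a, b, c, d, e)\<in>{(a, b, c, d, e). a + b + c + d + e = l \<and> 1 \<le> e}. 
       fact l * quad_weight T a b c d / fact e * (t ^ (2 * a + b) * X ^ e))"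
proof -
  define f where "f = (\<lambda>(a, b, c, d, e). fact l * quad_weight T a b c d / fact e * (t ^ (2 * a + b) * X ^ e))"
  have eq: "quadratic T t + X = T * t\<^sup>2 + (- T * t + (T / 6 + (- (pi\<^sup>2 / (6 * T)) + X)))"
    by (simp add: quadratic_def algebra_simps)
  have "(quadratic T t + X) ^ l = fact l * ((T * t\<^sup>2 + (- T * t + (T / 6 + (- (pi\<^sup>2 / (6 * T)) + X)))) ^ l / fact l)"
    unfolding eq by simp
  also have "\<dots> = (\<Sum>p\<in>compositions5 l. f p)"
    unfolding divided_power_add5 sum_distrib_left f_def
    by (intro sum.cong refl, simp only: quad_weight_def power_mult_distrib power_add power_mult case_prod_unfold)
       (simp only: times_divide_eq_left times_divide_eq_right divide_divide_eq_left mult_ac)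
  also have "compositions5 l = {(a, b, c, d, e). a + b + c + d + e = l \<and> 1 \<le> e} \<union> 
      (\<lambda>(a, b, c, d). (a, b, c, d, 0)) ` compositions4 l"
    by (auto simp: image_iff)
  also have "sum f \<dots> = sum f {(a, b, c, d, e). a + b + c + d + e = l \<and> 1 \<le> e} + 
      sum f ((\<lambda>(a, b, c, d). (a, b, c, d, 0)) ` compositions4 l)"
    by (intro sum.union_disjoint finite_imageI finite_compositions4)
       (auto intro: finite_subset[OF _ finite_compositions5[of l]])
  also have "sum f ((\<lambda>(a, b, c, d). (a, b, c, d, 0)) ` compositions4 l) = quadratic T t ^ l"
    unfolding quadratic_power by (subst sum.reindex) (auto simp: inj_on_def f_def case_prod_unfold)
  finally show ?thesis unfolding f_def by simp
qed

lemma set_integral_weighted_sum: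
  fixes f :: "'i \<Rightarrow> real \<Rightarrow> real"
  assumes "\<And>i. i \<in> I \<Longrightarrow> set_integrable lborel S (f i)"
  shows "set_integrable lborel S (\<lambda>t. \<Sum>i\<in>I. c i * f i t)"
    and "(LINT t:S|lborel. (\<Sum>i\<in>I. c i * f i t)) = (\<Sum>i\<in>I. c i * (LINT t:S|lborel. f i t))"
proof -
  have *: "set_integrable lborel S (\<lambda>t. c i * f i t)" if "i \<in> I" for i
    using assms[OF that] by (intro set_integrable_mult_right)
  show "set_integrable lborel S (\<lambda>t. \<Sum>i\<in>I. c i * f i t)"
    using * unfolding set_integrable_def scaleR_sum_right by (intro Bochner_Integration.integrable_sum) auto
  have "(LINT t:S|lborel. (\<Sum>i\<in>I. c i * f i t)) = (\<Sum>i\<in>I. LINT t:S|lborel. c i * f i t)"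
    using * unfolding set_integrable_def set_lebesgue_integral_def scaleR_sum_right
    by (intro Bochner_Integration.integral_sum) auto
  thus "(LINT t:S|lborel. (\<Sum>i\<in>I. c i * f i t)) = (\<Sum>i\<in>I. c i * (LINT t:S|lborel. f i t))"
    by simp
qed

lemma monomial_integral:
  "set_integrable lborel {0<..<1} (\<lambda>t::real. t ^ k)"
  "(LINT t:{0<..<1}|lborel. t ^ k) = 1 / real (Suc k)"
proof -
  show 1: "set_integrable lborel {0<..<1} (\<lambda>t::real. t ^ k)"
    by (rule set_integrable_subset[of _ "{0..1}"]) (auto intro!: borel_integrable_atLeastAtMost' continuous_intros)
  have "((\<lambda>t::real. t ^ k) has_integral (1 ^ Suc k / real (Suc k) - 0 ^ Suc k / real (Suc k))) {0..1}"
  proof (rule fundamental_theorem_of_calculus)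
    have "((\<lambda>x::real. x ^ Suc k / real (Suc k)) has_real_derivative x ^ k) (at x within {0..1})" for x
      by (rule DERIV_cong[OF DERIV_cdivide[OF DERIV_power[OF DERIV_ident, of "Suc k"], of "real (Suc k)"]])
         (simp del: of_nat_Suc)
    thus "((\<lambda>x::real. x ^ Suc k / real (Suc k)) has_vector_derivative x ^ k) (at x within {0..1})" for x
      by (simp only: has_real_derivative_iff_has_vector_derivative)
  qed auto
  hence "((\<lambda>t::real. t ^ k) has_integral (1 / real (Suc k))) {0<..<1}"
    by (simp add: has_integral_Icc_iff_Ioo)
  thus "(LINT t:{0<..<1}|lborel. t ^ k) = 1 / real (Suc k)"
    using set_borel_integral_eq_integral(2)[OF 1] by (simp add: integral_unique)
qed

lemma quadratic_power_integral:
  "set_integrable lborel {0<..<1} (\<lambda>t. quadratic T t ^ l)"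
  "(LINT t:{0<..<1}|lborel. quadratic T t ^ l) = 
     (\<Sum>(a, b, c, d)\<in>compositions4 l. fact l * quad_weight T a b c d / real (2 * a + b + 1))"
  using set_integral_weighted_sum[of "compositions4 l" "{0<..<1}" "\<lambda>(a, b, c, d) t. t ^ (2 * a + b)" 
      "\<lambda>(a, b, c, d). fact l * quad_weight T a b c d"]
  unfolding quadratic_power by (simp_all add: monomial_integral case_prod_unfold)

text \<open>Since e >= 1 in every term, each polynomial in t is multiplied by a decaying
  \<open>logterm\<close>, which makes the half-line integral converge. The e! of the moment cancels
  the 1 / e! of the expansion.\<close>

lemma excess_integral:
  assumes "0 < T"
  shows "set_integrable lborel {0<..} (\<lambda>t. (quadratic T t + logterm T t) ^ l - quadratic T t ^ l)"
  and "(LINT t:{0<..}|lborel. (quadratic T t + logterm T t) ^ l - quadratic T t ^ l) = 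
     (\<Sum>(a, b, c, d, e)\<in>{(a, b, c, d, e). a + b + c + d + e = l \<and> 1 \<le> e}. 
       fact l * quad_weight T a b c d * (fact (2 * a + b) / (2 * T) ^ (2 * a + b + 1) * H (2 * a + b + 1) e))"
proof -
  let ?I = "{(a, b, c, d, e). a + b + c + d + e = l \<and> 1 \<le> e}"
  have 1: "set_integrable lborel {0<..} (\<lambda>t. t ^ k * logterm T t ^ e)" if "1 \<le> e" for k e
    using power_logterm_integral(1)[OF assms, of k "e - 1"] that by simp
  have 2: "(LINT t:{0<..}|lborel. t ^ k * logterm T t ^ e) = fact e * fact k / (2 * T) ^ Suc k * H (Suc k) e" if "1 \<le> e" for k e
    using power_logterm_integral(2)[OF assms, of k "e - 1"] that by simp
  have 3: "set_integrable lborel {0<..} ((\<lambda>(a, b, c, d, e) t. t ^ (2 * a + b) * logterm T t ^ e) p)" if "p \<in> ?I" for p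
    using that 1 by auto
  note * = set_integral_weighted_sum[of ?I "{0<..}" "\<lambda>(a, b, c, d, e) t. t ^ (2 * a + b) * logterm T t ^ e" 
      "\<lambda>(a, b, c, d, e). fact l * quad_weight T a b c d / fact e", OF 3]
  show "set_integrable lborel {0<..} (\<lambda>t. (quadratic T t + logterm T t) ^ l - quadratic T t ^ l)"
    using *(1) unfolding excess_power by (simp add: case_prod_unfold)
  have "(LINT t:{0<..}|lborel. (quadratic T t + logterm T t) ^ l - quadratic T t ^ l) = 
     (\<Sum>(a, b, c, d, e)\<in>?I. fact l * quad_weight T a b c d / fact e * 
       (LINT t:{0<..}|lborel. t ^ (2 * a + b) * logterm T t ^ e))"
    using *(2) unfolding excess_power by (simp add: case_prod_unfold)
  also have "\<dots> = (\<Sum>(a, b, c, d, e)\<in>?I. 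
       fact l * quad_weight T a b c d * (fact (2 * a + b) / (2 * T) ^ (2 * a + b + 1) * H (2 * a + b + 1) e))"
    by (intro sum.cong refl) (auto simp: 2)
  finally show "(LINT t:{0<..}|lborel. (quadratic T t + logterm T t) ^ l - quadratic T t ^ l) = 
     (\<Sum>(a, b, c, d, e)\<in>?I. 
       fact l * quad_weight T a b c d * (fact (2 * a + b) / (2 * T) ^ (2 * a + b + 1) * H (2 * a + b + 1) e))" .
qed

section \<open>Error estimates uniform in T\<close>

lemma set_integral_dominated:
  fixes f g :: "real \<Rightarrow> real"
  assumes g: "set_integrable lborel S g" and f: "f \<in> borel_measurable borel" and S: "S \<in> sets borel"
    and le: "\<And>t. t \<in> S \<Longrightarrow> \<bar>f t\<bar> \<le> g t"
  shows "set_integrable lborel S f" and "\<bar>LINT t:S|lborel. f t\<bar> \<le> (LINT t:S|lborel. g t)"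
proof -
  show f_int: "set_integrable lborel S f"
  proof (rule set_integrable_bound[OF g])
    show "set_borel_measurable lborel S f"
      unfolding set_borel_measurable_def using f S by measurable
    show "AE t in lborel. t \<in> S \<longrightarrow> norm (f t) \<le> norm (g t)"
      using le by (auto intro!: AE_I2 order_trans[OF _ abs_ge_self])
  qed
  have "norm (LINT t:S|lborel. f t) \<le> (LINT t:S|lborel. norm (f t))"
    by (rule set_integral_norm_bound[OF f_int])
  also have "\<dots> \<le> (LINT t:S|lborel. g t)"
    using le by (intro set_integral_mono set_integrable_norm f_int g) auto
  finally show "\<bar>LINT t:S|lborel. f t\<bar> \<le> (LINT t:S|lborel. g t)" by simp
qed

lemma set_integral_flip_unit:
  fixes f :: "real \<Rightarrow> real"
  shows "set_integrable lborel {0<..<1} f \<Longrightarrow> set_integrable lborel {0<..<1} (\<lambda>t. f (1 - t))"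
    and "(LINT t:{0<..<1}|lborel. f (1 - t)) = (LINT t:{0<..<1}|lborel. f t)"
proof -
  have *: "indicator {0<..<1} (1 + (- 1) * t) = (indicator {0<..<1} t :: real)" for t :: real
    by (auto simp: indicator_def)
  show "set_integrable lborel {0<..<1} f \<Longrightarrow> set_integrable lborel {0<..<1} (\<lambda>t. f (1 - t))"
    unfolding set_integrable_def 
    using lborel_integrable_real_affine[of "\<lambda>t. indicator {0<..<1} t *\<^sub>R f t" "-1" 1] * by simp
  show "(LINT t:{0<..<1}|lborel. f (1 - t)) = (LINT t:{0<..<1}|lborel. f t)"
    unfolding set_lebesgue_integral_def 
    using lborel_integral_real_affine[of "-1" "\<lambda>t. indicator {0<..<1} t *\<^sub>R f t" 1] * by simp
qed

text \<open>A mean value estimate; M >= 1 permits the exponent n in place of n - 1.\<close>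

lemma abs_power_diff_le:
  fixes a b M :: real
  assumes "\<bar>a\<bar> \<le> M" "\<bar>b\<bar> \<le> M" "1 \<le> M"
  shows "\<bar>a ^ n - b ^ n\<bar> \<le> real n * \<bar>a - b\<bar> * M ^ n"
proof (induction n)
  case (Suc n)
  have "a ^ Suc n - b ^ Suc n = a * (a ^ n - b ^ n) + (a - b) * b ^ n"
    by (simp add: algebra_simps)
  also have "\<bar>\<dots>\<bar> \<le> \<bar>a\<bar> * \<bar>a ^ n - b ^ n\<bar> + \<bar>a - b\<bar> * \<bar>b\<bar> ^ n"
    by (rule order_trans[OF abs_triangle_ineq]) (simp add: abs_mult power_abs)
  also have "\<dots> \<le> M * (real n * \<bar>a - b\<bar> * M ^ n) + \<bar>a - b\<bar> * M ^ n"
    using assms Suc by (intro add_mono mult_mono power_mono) auto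
  also have "\<dots> \<le> M * (real n * \<bar>a - b\<bar> * M ^ n) + \<bar>a - b\<bar> * M ^ Suc n"
    using assms by (intro add_left_mono mult_left_mono power_increasing) auto
  also have "\<dots> = real (Suc n) * \<bar>a - b\<bar> * M ^ Suc n"
    by (simp add: algebra_simps)
  finally show ?case .
qed simp

text \<open>A discrete mixed second derivative, hence the factor X Y. One induction step adds two
  first differences of size n X Y M ^ n, and n ^ 2 + 2 n <= (n + 1) ^ 2 absorbs them.\<close>

lemma second_difference_power_le:
  fixes A X Y M :: real
  assumes M: "\<bar>A\<bar> + X + Y \<le> M" "1 \<le> M" and XY: "0 \<le> X" "0 \<le> Y"
  shows "\<bar>(A + X + Y) ^ n - (A + X) ^ n - (A + Y) ^ n + A ^ n\<bar> \<le> (real n)\<^sup>2 * (X * Y) * M ^ n"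
proof (induction n)
  case (Suc n)
  define D where "D = (A + X + Y) ^ n - (A + X) ^ n - (A + Y) ^ n + A ^ n"
  have 1: "\<bar>(A + X) ^ n - A ^ n\<bar> \<le> real n * X * M ^ n"
    using abs_power_diff_le[of "A + X" M A n] M XY by auto
  have 2: "\<bar>(A + Y) ^ n - A ^ n\<bar> \<le> real n * Y * M ^ n"
    using abs_power_diff_le[of "A + Y" M A n] M XY by auto
  have "(A + X + Y) ^ Suc n - (A + X) ^ Suc n - (A + Y) ^ Suc n + A ^ Suc n = 
      (A + X + Y) * D + Y * ((A + X) ^ n - A ^ n) + X * ((A + Y) ^ n - A ^ n)"
    by (simp add: D_def algebra_simps)
  also have "\<bar>\<dots>\<bar> \<le> \<bar>A + X + Y\<bar> * \<bar>D\<bar> + Y * \<bar>(A + X) ^ n - A ^ n\<bar> + X * \<bar>(A + Y) ^ n - A ^ n\<bar>"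
    using XY by (intro order_trans[OF abs_triangle_ineq] add_mono) (auto simp: abs_mult)
  also have "\<dots> \<le> M * ((real n)\<^sup>2 * (X * Y) * M ^ n) + Y * (real n * X * M ^ n) + X * (real n * Y * M ^ n)"
    using M XY Suc 1 2 by (intro add_mono mult_mono mult_left_mono) (auto simp: D_def)
  also have "\<dots> = ((real n)\<^sup>2 * (X * Y)) * M ^ Suc n + (2 * real n * (X * Y)) * M ^ n"
    by (simp add: algebra_simps)
  also have "\<dots> \<le> ((real n)\<^sup>2 * (X * Y)) * M ^ Suc n + (2 * real n * (X * Y)) * M ^ Suc n"
    using M XY by (intro add_left_mono mult_left_mono power_increasing) auto
  also have "\<dots> = ((real n)\<^sup>2 + 2 * real n) * (X * Y) * M ^ Suc n"
    by (simp add: algebra_simps)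
  also have "\<dots> \<le> (real (Suc n))\<^sup>2 * (X * Y) * M ^ Suc n"
    using M XY by (intro mult_right_mono) (auto simp: power2_eq_square algebra_simps)
  finally show ?case .
qed simp

lemma logterm_tail_le:
  assumes T: "1 \<le> T" and s: "real n + 1 \<le> s"
  shows "logterm T s \<le> exp (- (2 * T)) * ((1 + logterm 1 1) * exp (- 2) ^ n)"
proof -
  \<comment> \<open>This bounds the product T s below by T + s - 1, so the exponential separates
    into decay in T and summability in n.\<close>
  have "0 \<le> (T - 1) * (s - 1)" using T s by (intro mult_nonneg_nonneg) auto
  hence Ts: "T + real n \<le> T * s" using s by (simp add: algebra_simps)
  have "logterm T s \<le> exp (- (2 * T * s)) * (1 + logterm 1 s)"
    using assms by (intro logterm_le_exp) auto
  also have "\<dots> \<le> exp (- (2 * (T + real n))) * (1 + logterm 1 1)"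
    using assms Ts by (intro mult_mono add_left_mono logterm_mono add_nonneg_nonneg logterm_nonneg) auto
  also have "exp (- (2 * (T + real n))) = exp (- (2 * T)) * exp (- 2) ^ n"
    by (simp add: exp_of_nat_mult[symmetric] flip: exp_add)
  finally show ?thesis by (simp add: mult_ac)
qed

lemma remainder_bound:
  obtains C where "0 \<le> C" "\<And>T t. 1 \<le> T \<Longrightarrow> 0 < t \<Longrightarrow> t < 1 \<Longrightarrow> 0 \<le> remainder T t \<and> remainder T t \<le> C * exp (- (2 * T))"
proof
  define h where "h = (\<lambda>n::nat. (1 + logterm 1 1) * exp (- 2) ^ n)"
  have h: "summable h" unfolding h_def by (intro summable_mult summable_geometric) auto
  have h_nonneg: "0 \<le> h n" for n
    unfolding h_def by (intro mult_nonneg_nonneg add_nonneg_nonneg logterm_nonneg) auto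
  show "0 \<le> 2 * suminf h" using h h_nonneg by (auto intro!: suminf_nonneg)
  fix T t :: real assume T: "1 \<le> T" and t: "0 < t" "t < 1"
  have le: "logterm T (real n + 1 + t) + logterm T (real n + 2 - t) \<le> 2 * exp (- (2 * T)) * h n" for n
    using logterm_tail_le[OF T, of n "real n + 1 + t"] logterm_tail_le[OF T, of n "real n + 2 - t"] t
    unfolding h_def by auto
  have nonneg: "0 \<le> logterm T (real n + 1 + t) + logterm T (real n + 2 - t)" for n
    using T t by (intro add_nonneg_nonneg logterm_nonneg) auto
  have sm: "summable (\<lambda>n. logterm T (real n + 1 + t) + logterm T (real n + 2 - t))"
    using summable_logterm[of T "1 + t"] summable_logterm[of T "2 - t"] T t
    by (intro summable_add) (auto simp: algebra_simps)
  have "remainder T t \<le> suminf (\<lambda>n. 2 * exp (- (2 * T)) * h n)"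
    unfolding remainder_def using le h by (intro suminf_le sm summable_mult) auto
  also have "\<dots> = 2 * suminf h * exp (- (2 * T))"
    using suminf_mult[OF h, of "2 * exp (- (2 * T))"] by (simp add: mult_ac)
  finally show "0 \<le> remainder T t \<and> remainder T t \<le> 2 * suminf h * exp (- (2 * T))"
    unfolding remainder_def using suminf_nonneg[OF sm nonneg] by simp
qed

lemma remainder_measurable [measurable]: "remainder T \<in> borel_measurable borel"
  unfolding remainder_def by measurable

lemma quadratic_measurable [measurable]: "quadratic T \<in> borel_measurable borel"
  unfolding quadratic_def by measurable

lemma potential_measurable [measurable]: "potential T \<in> borel_measurable borel"
  unfolding potential_def by measurable

text \<open>Stated for all t >= 0 to serve both the unit interval and the tail. The 4 is 1 for the
  Bernoulli polynomial plus 3 for pi ^ 2 / (6 T), estimated with pi < 4.\<close>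

lemma abs_quadratic_le:
  assumes "1 \<le> T" "0 \<le> t"
  shows "\<bar>quadratic T t\<bar> \<le> T * (4 * (1 + t)\<^sup>2)"
proof -
  have "pi\<^sup>2 \<le> 4\<^sup>2" using pi_less_4 by (intro power_mono) auto
  hence "pi\<^sup>2 / (6 * T) \<le> 16 / (6 * 1)"
    using assms by (intro frac_le) auto
  also have "\<dots> \<le> 3 * T" using assms by simp
  finally have 1: "pi\<^sup>2 / (6 * T) \<le> 3 * T" .
  have 2: "0 \<le> pi\<^sup>2 / (6 * T)" using assms by simp
  have "\<bar>t\<^sup>2 - t + 1/6\<bar> \<le> (1 + t)\<^sup>2"
    using assms unfolding abs_le_iff by (simp add: power2_eq_square algebra_simps)
  hence 3: "\<bar>T * (t\<^sup>2 - t + 1/6)\<bar> \<le> T * (1 + t)\<^sup>2"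
    using assms by (simp add: abs_mult)
  have "T * 1 \<le> T * (1 + t)\<^sup>2"
    using assms by (intro mult_left_mono) auto
  with 1 2 3 show ?thesis unfolding quadratic_def by (simp add: abs_le_iff)
qed

lemma power_add3_le:
  fixes x y z :: real
  assumes "0 \<le> x" "0 \<le> y" "0 \<le> z"
  shows "(x + y + z) ^ n \<le> 3 ^ n * (x ^ n + y ^ n + z ^ n)"
proof -
  define m where "m = max x (max y z)"
  have "(x + y + z) ^ n \<le> (3 * m) ^ n"
    using assms by (intro power_mono) (auto simp: m_def)
  also have "\<dots> = 3 ^ n * m ^ n" by (simp add: power_mult_distrib)
  also have "m ^ n \<le> x ^ n + y ^ n + z ^ n"
    using assms by (auto simp: m_def max_def)
  finally show ?thesis by simp
qed

text \<open>Logarithmic singularities are integrable to every power; the power of the sum is bounded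
  by the powers of its three summands, and the end t = 1 is reflected to t = 0.\<close>

lemma envelope_integrable:
  assumes "0 \<le> C"
  shows "set_integrable lborel {0<..<1} (\<lambda>t. (C + logterm 1 t + logterm 1 (1 - t)) ^ Suc n)"
proof -
  have 1: "set_integrable lborel {0<..<1} (\<lambda>t. logterm 1 t ^ Suc n)"
  proof -
    have "set_integrable lborel {0<..<1} (\<lambda>t. t ^ 0 * logterm 1 t ^ Suc n)"
      by (rule set_integrable_subset[OF power_logterm_integral(1)]) auto
    thus ?thesis by simp
  qed
  have 2: "set_integrable lborel {0<..<1} (\<lambda>t::real. C ^ Suc n)"
    using set_integrable_mult_right[OF monomial_integral(1)[of 0], of "C ^ Suc n"] by simp
  have "set_integrable lborel {0<..<1} (\<lambda>t. 3 ^ Suc n * (C ^ Suc n + logterm 1 t ^ Suc n + logterm 1 (1 - t) ^ Suc n))"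
    by (intro set_integrable_mult_right set_integral_add(1) 1 2 set_integral_flip_unit(1)[OF 1])
  thus ?thesis
  proof (rule set_integral_dominated(1))
    fix t :: real assume t: "t \<in> {0<..<1}"
    have "0 \<le> logterm 1 t" "0 \<le> logterm 1 (1 - t)" using t by (auto intro!: logterm_nonneg)
    thus "\<bar>(C + logterm 1 t + logterm 1 (1 - t)) ^ Suc n\<bar> \<le> 3 ^ Suc n * (C ^ Suc n + logterm 1 t ^ Suc n + logterm 1 (1 - t) ^ Suc n)"
      using power_add3_le[of C "logterm 1 t" "logterm 1 (1 - t)" "Suc n"] assms
      by (simp only: abs_of_nonneg zero_le_power add_nonneg_nonneg)
  qed auto
qed

text \<open>With \<open>X = g(t)\<close> and \<open>Y = g(1 - t)\<close>, the second difference
  \<open>(A + X + Y) ^ l - (A + X) ^ l - (A + Y) ^ l + A ^ l\<close> carries a factor \<open>X Y\<close>, and the contributions of \<open>X\<close> and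
  \<open>Y\<close> agree by symmetry. \<open>W\<close> is an integrable envelope not depending on \<open>T\<close>.\<close>

lemma potential_integral_cut:
  "\<exists>K. \<forall>T\<ge>1. set_integrable lborel {0<..<1} (\<lambda>t. potential T t ^ l) \<and>
     \<bar>(LINT t:{0<..<1}|lborel. potential T t ^ l) - (LINT t:{0<..<1}|lborel. quadratic T t ^ l)
        - 2 * (LINT t:{0<..<1}|lborel. (quadratic T t + logterm T t) ^ l - quadratic T t ^ l)\<bar>
     \<le> K * (T ^ l * exp (- (2 * T)))"
proof -
  obtain C where C: "0 \<le> C" "\<And>T t. 1 \<le> T \<Longrightarrow> 0 < t \<Longrightarrow> t < 1 \<Longrightarrow> 0 \<le> remainder T t \<and> remainder T t \<le> C * exp (- (2 * T))"
    using remainder_bound by blast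
  \<comment> \<open>The 17 exceeds 16 = 4 * (1 + 1) ^ 2, the bound for \<open>quadratic\<close>
    divided by T on the unit interval; C covers the remainder.\<close>
  define W where "W = (\<lambda>t. (17 + C) + logterm 1 t + logterm 1 (1 - t))"
  \<comment> \<open>l ^ 2 comes from the second difference and l from removing the remainder. In the
    exponent l + 2, l belongs to the bound (T W) ^ l and 2 to the bound on X Y plus the
    remainder.\<close>
  define K where "K = 2 * ((real l)\<^sup>2 + real l) * (LINT t:{0<..<1}|lborel. W t ^ (l + 2))"
  have W_int: "set_integrable lborel {0<..<1} (\<lambda>t. W t ^ Suc n)" for n
    unfolding W_def using C by (intro envelope_integrable) auto
  show ?thesis
  proof (intro exI[of _ K] allI impI)
    fix T :: real assume T: "1 \<le> T"
    define X where "X = (\<lambda>t. logterm T t)"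
    define Y where "Y = (\<lambda>t. logterm T (1 - t))"
    define S where "S = (\<lambda>t. (quadratic T t + X t) ^ l + (quadratic T t + Y t) ^ l - quadratic T t ^ l)"
    have [measurable]: "X \<in> borel_measurable borel" "Y \<in> borel_measurable borel" 
      unfolding X_def Y_def by measurable
    have [measurable]: "S \<in> borel_measurable borel"
      unfolding S_def by measurable
    have bounds: "0 \<le> X t" "0 \<le> Y t" "0 \<le> remainder T t" "1 \<le> W t" 
       "\<bar>quadratic T t\<bar> + X t + Y t + remainder T t \<le> T * W t" "1 \<le> T * W t"
       "X t * Y t + remainder T t \<le> 2 * exp (- (2 * T)) * W t ^ 2" if "t \<in> {0<..<1}" for t
    proof -
      have t: "0 < t" "t < 1" using that by auto
      have L: "0 \<le> logterm 1 t" "0 \<le> logterm 1 (1 - t)" using t by (auto intro!: logterm_nonneg)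
      show X0: "0 \<le> X t" and Y0: "0 \<le> Y t" unfolding X_def Y_def using T t by (auto intro!: logterm_nonneg)
      have R: "0 \<le> remainder T t" "remainder T t \<le> C * exp (- (2 * T))" using C(2)[OF T t] by auto
      show "0 \<le> remainder T t" by fact
      show W1: "1 \<le> W t" using L C unfolding W_def by simp
      have XY1: "X t \<le> logterm 1 t" "Y t \<le> logterm 1 (1 - t)"
        unfolding X_def Y_def using T t by (auto intro!: logterm_mono)
      have "C * exp (- (2 * T)) \<le> C * 1" using C T by (intro mult_left_mono) auto
      hence R1: "remainder T t \<le> C" using R by simp
      have "(1 + t)\<^sup>2 \<le> 2\<^sup>2" using t by (intro power_mono) auto
      hence "T * (4 * (1 + t)\<^sup>2) \<le> T * 16" using T by (intro mult_left_mono) auto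
      hence Q: "\<bar>quadratic T t\<bar> \<le> T * 16" using abs_quadratic_le[OF T, of t] t by linarith
      have "X t + Y t + remainder T t \<le> 1 * (C + logterm 1 t + logterm 1 (1 - t))"
        using XY1 R1 by simp
      also have "\<dots> \<le> T * (C + logterm 1 t + logterm 1 (1 - t))"
        using T C L by (intro mult_right_mono) auto
      finally show TW: "\<bar>quadratic T t\<bar> + X t + Y t + remainder T t \<le> T * W t"
        using Q T unfolding W_def by (simp add: algebra_simps)
      show "1 \<le> T * W t" using mult_mono[of 1 T 1 "W t"] T W1 by simp
      have "X t * Y t \<le> (exp (- (2 * T * t)) * (1 + logterm 1 t)) * (exp (- (2 * T * (1 - t))) * (1 + logterm 1 (1 - t)))"
        using X0 Y0 L T t unfolding X_def Y_def by (intro mult_mono logterm_le_exp) auto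
      \<comment> \<open>The rates 2 T t and 2 T (1 - t) add up to 2 T for every t, so the overlap of
        the two ends is uniformly small.\<close>
      also have "\<dots> = exp (- (2 * T)) * ((1 + logterm 1 t) * (1 + logterm 1 (1 - t)))"
        by (simp add: algebra_simps flip: exp_add)
      also have "\<dots> \<le> exp (- (2 * T)) * (W t * W t)"
        using L C unfolding W_def by (intro mult_left_mono mult_mono) auto
      finally have 1: "X t * Y t \<le> exp (- (2 * T)) * W t ^ 2" by (simp add: power2_eq_square)
      have "C \<le> W t * 1" using L unfolding W_def by simp
      also have "\<dots> \<le> W t * W t" using W1 by (intro mult_left_mono) auto
      finally have "exp (- (2 * T)) * C \<le> exp (- (2 * T)) * W t ^ 2"
        by (intro mult_left_mono) (auto simp: power2_eq_square)
      with 1 R show "X t * Y t + remainder T t \<le> 2 * exp (- (2 * T)) * W t ^ 2"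
        by (simp only: mult.commute[of C])
    qed
    have dom: "set_integrable lborel {0<..<1} (\<lambda>t. f t ^ l)"
      if "f \<in> borel_measurable borel" "\<And>t. t \<in> {0<..<1} \<Longrightarrow> \<bar>f t\<bar> \<le> T * W t" for f :: "real \<Rightarrow> real"
    proof (rule set_integral_dominated(1))
      \<comment> \<open>Integrability of W is available for positive exponents; raising l to
        \<open>Suc l\<close> is harmless because W >= 1, and it covers l = 0.\<close>
      show "set_integrable lborel {0<..<1} (\<lambda>t. T ^ l * W t ^ Suc l)"
        by (intro set_integrable_mult_right W_int)
      fix t :: real assume t: "t \<in> {0<..<1}"
      have "\<bar>f t ^ l\<bar> \<le> (T * W t) ^ l"
        unfolding power_abs using that(2)[OF t] by (intro power_mono) auto
      also have "\<dots> \<le> T ^ l * W t ^ Suc l"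
        unfolding power_mult_distrib using bounds(4)[OF t] T by (intro mult_left_mono power_increasing) auto
      finally show "\<bar>f t ^ l\<bar> \<le> T ^ l * W t ^ Suc l" .
    qed (use that(1) in auto)
    have int_P: "set_integrable lborel {0<..<1} (\<lambda>t. potential T t ^ l)"
    proof (rule dom)
      fix t :: real assume t: "t \<in> {0<..<1}"
      show "\<bar>potential T t\<bar> \<le> T * W t"
        using bounds(1-3,5)[OF t] unfolding potential_def X_def Y_def by linarith
    qed simp
    have int_A: "set_integrable lborel {0<..<1} (\<lambda>t. quadratic T t ^ l)"
      by (rule quadratic_power_integral)
    have int_X: "set_integrable lborel {0<..<1} (\<lambda>t. (quadratic T t + X t) ^ l)"
    proof (rule dom)
      fix t :: real assume t: "t \<in> {0<..<1}"
      show "\<bar>quadratic T t + X t\<bar> \<le> T * W t" using bounds(1-3,5)[OF t] by linarith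
    qed measurable
    have flip: "quadratic T (1 - t) = quadratic T t" for t
      by (simp add: quadratic_def power2_eq_square algebra_simps)
    have int_Y: "set_integrable lborel {0<..<1} (\<lambda>t. (quadratic T t + Y t) ^ l)"
      and Y_eq: "(LINT t:{0<..<1}|lborel. (quadratic T t + Y t) ^ l) = (LINT t:{0<..<1}|lborel. (quadratic T t + X t) ^ l)"
      using set_integral_flip_unit[of "\<lambda>t. (quadratic T t + X t) ^ l"] int_X
      unfolding flip by (simp_all add: X_def Y_def)
    have int_S: "set_integrable lborel {0<..<1} S"
      unfolding S_def by (intro set_integral_add(1) set_integral_diff(1) int_X int_Y int_A)
    have S_eq: "(LINT t:{0<..<1}|lborel. S t) = (LINT t:{0<..<1}|lborel. quadratic T t ^ l)
        + 2 * (LINT t:{0<..<1}|lborel. (quadratic T t + X t) ^ l - quadratic T t ^ l)"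
      unfolding S_def by (simp add: set_integral_add set_integral_diff int_X int_Y int_A Y_eq)
    have "\<bar>LINT t:{0<..<1}|lborel. potential T t ^ l - S t\<bar> \<le>
       (LINT t:{0<..<1}|lborel. 2 * ((real l)\<^sup>2 + real l) * (T ^ l * exp (- (2 * T))) * W t ^ (l + 2))"
    proof (rule set_integral_dominated(2))
      show "set_integrable lborel {0<..<1} (\<lambda>t. 2 * ((real l)\<^sup>2 + real l) * (T ^ l * exp (- (2 * T))) * W t ^ (l + 2))"
        using W_int[of "Suc l"] by (intro set_integrable_mult_right) simp
      fix t :: real assume t: "t \<in> {0<..<1}"
      note b = bounds[OF t]
      define A where "A = quadratic T t"
      define R where "R = remainder T t"
      define M where "M = T * W t"
      have M: "\<bar>A\<bar> + X t + Y t \<le> M" "\<bar>A + X t + Y t + R\<bar> \<le> M" "\<bar>A + X t + Y t\<bar> \<le> M" "1 \<le> M"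
        using b unfolding A_def R_def M_def by linarith+
      have "potential T t ^ l - S t = ((A + X t + Y t + R) ^ l - (A + X t + Y t) ^ l) + 
          ((A + X t + Y t) ^ l - (A + X t) ^ l - (A + Y t) ^ l + A ^ l)"
        by (simp add: S_def potential_def A_def R_def X_def Y_def)
      also have "\<bar>\<dots>\<bar> \<le> real l * R * M ^ l + (real l)\<^sup>2 * (X t * Y t) * M ^ l"
        by (rule order_trans[OF abs_triangle_ineq add_mono])
           (use abs_power_diff_le[OF M(2,3,4), of l] second_difference_power_le[OF M(1,4) b(1,2), of l] b(3)
             in \<open>simp_all add: R_def\<close>)
      also have "\<dots> \<le> ((real l)\<^sup>2 + real l) * (X t * Y t + R) * M ^ l"
        using b(1-3) M(4) unfolding R_def
        by (simp add: algebra_simps add_nonneg_nonneg)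
      also have "\<dots> \<le> ((real l)\<^sup>2 + real l) * (2 * exp (- (2 * T)) * W t ^ 2) * M ^ l"
        using b(7) M(4) unfolding R_def by (intro mult_right_mono mult_left_mono) auto
      also have "\<dots> = 2 * ((real l)\<^sup>2 + real l) * (T ^ l * exp (- (2 * T))) * W t ^ (l + 2)"
        unfolding M_def by (simp add: power_mult_distrib power_add power2_eq_square mult_ac)
      finally show "\<bar>potential T t ^ l - S t\<bar> \<le> 2 * ((real l)\<^sup>2 + real l) * (T ^ l * exp (- (2 * T))) * W t ^ (l + 2)" .
    next
      show "(\<lambda>t. potential T t ^ l - S t) \<in> borel_measurable borel" by measurable
    qed simp
    also have "\<dots> = K * (T ^ l * exp (- (2 * T)))"
      unfolding K_def set_integral_mult_right by (simp only: mult_ac)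
    finally show "set_integrable lborel {0<..<1} (\<lambda>t. potential T t ^ l) \<and>
     \<bar>(LINT t:{0<..<1}|lborel. potential T t ^ l) - (LINT t:{0<..<1}|lborel. quadratic T t ^ l)
        - 2 * (LINT t:{0<..<1}|lborel. (quadratic T t + logterm T t) ^ l - quadratic T t ^ l)\<bar>
     \<le> K * (T ^ l * exp (- (2 * T)))"
      using int_P by (simp add: set_integral_diff int_S S_eq X_def algebra_simps)
  qed
qed

text \<open>This is the cost of replacing the unit interval by the half line. Beyond t = 1 the
  logarithm is bounded, and T t >= T + t - 1 splits its decay into exp (- 2 T) and a factor exp (- 2
  t) that beats the polynomial growth.\<close>

lemma excess_tail_bound:
  "\<exists>K. \<forall>T\<ge>1. \<bar>LINT t:{1..}|lborel. (quadratic T t + logterm T t) ^ l - quadratic T t ^ l\<bar> \<le> K * (T ^ l * exp (- (2 * T)))"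
proof -
  \<comment> \<open>16 comes from 4 (1 + t) ^ 2 <= 16 t ^ 2 for t >= 1, and
    \<open>logterm 1 1\<close> bounds the logarithm there.\<close>
  define c where "c = 16 + logterm 1 1"
  have c: "1 \<le> c" unfolding c_def using logterm_nonneg[of 1 1] by simp
  have int: "set_integrable lborel {1..} (\<lambda>t::real. t ^ (2 * l) * logterm 1 t)"
  proof -
    have "set_integrable lborel {1..} (\<lambda>t. t ^ (2 * l) * logterm 1 t ^ Suc 0)"
      by (rule set_integrable_subset[OF power_logterm_integral(1)]) auto
    thus ?thesis by simp
  qed
  define K where "K = real l * exp 2 * (c * c ^ l) * (LINT t:{1..}|lborel. t ^ (2 * l) * logterm 1 t)"
  show ?thesis
  proof (intro exI[of _ K] allI impI)
    fix T :: real assume T: "1 \<le> T"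
    have "\<bar>LINT t:{1..}|lborel. (quadratic T t + logterm T t) ^ l - quadratic T t ^ l\<bar> \<le> 
      (LINT t:{1..}|lborel. (real l * exp 2 * (c * c ^ l)) * (T ^ l * exp (- (2 * T))) * (t ^ (2 * l) * logterm 1 t))"
    proof (rule set_integral_dominated(2))
      show "set_integrable lborel {1..} (\<lambda>t. (real l * exp 2 * (c * c ^ l)) * (T ^ l * exp (- (2 * T))) * (t ^ (2 * l) * logterm 1 t))"
        by (intro set_integrable_mult_right int)
      fix t :: real assume "t \<in> {1..}"
      hence t: "1 \<le> t" by simp
      define X where "X = logterm T t"
      have X0: "0 \<le> X" unfolding X_def using T t by (intro logterm_nonneg) auto
      have L: "logterm 1 t \<le> logterm 1 1" using t by (intro logterm_mono) auto
      have X1: "X \<le> logterm 1 1"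
        unfolding X_def using T t mult_mono[of 1 T 1 t] by (intro logterm_mono) auto
      have "0 \<le> (T - 1) * (t - 1)" using T t by (intro mult_nonneg_nonneg) auto
      hence Tt: "T + t - 1 \<le> T * t" by (simp add: algebra_simps)
      \<comment> \<open>From - ln (1 - x) >= x: trading exp (- 2 t) for \<open>logterm 1 t\<close>
        turns the majorant into a moment already known to be integrable.\<close>
      have w: "exp (- (2 * t)) \<le> logterm 1 t"
        using ln_add_one_self_le_self2[of "- exp (- (2 * t))"] t by (simp add: logterm_def)
      have "X \<le> exp (- (2 * T * t)) * (1 + logterm 1 t)"
        unfolding X_def using T t by (intro logterm_le_exp) auto
      also have "\<dots> \<le> exp (2 + - (2 * T) + - (2 * t)) * c"
        using Tt L T t unfolding c_def by (intro mult_mono add_nonneg_nonneg logterm_nonneg) auto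
      also have "exp (2 + - (2 * T) + - (2 * t)) = exp 2 * exp (- (2 * T)) * exp (- (2 * t))"
        by (simp only: exp_add)
      also have "exp 2 * exp (- (2 * T)) * exp (- (2 * t)) * c \<le> exp 2 * exp (- (2 * T)) * logterm 1 t * c"
        using w c by (intro mult_right_mono mult_left_mono) auto
      finally have X2: "X \<le> exp 2 * exp (- (2 * T)) * logterm 1 t * c" .
      define M where "M = T * (c * t\<^sup>2)"
      have t2: "1 \<le> t\<^sup>2" using t by simp
      have "(1 + t)\<^sup>2 \<le> (2 * t)\<^sup>2" using t by (intro power_mono) auto
      hence "T * (4 * (1 + t)\<^sup>2) \<le> T * (16 * t\<^sup>2)"
        using T by (intro mult_left_mono) (auto simp: power_mult_distrib)
      hence Q: "\<bar>quadratic T t\<bar> \<le> T * (16 * t\<^sup>2)" using abs_quadratic_le[OF T, of t] t by linarith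
      have "X \<le> 1 * (logterm 1 1 * 1)" using X1 by simp
      also have "\<dots> \<le> T * (logterm 1 1 * t\<^sup>2)"
        using T t2 logterm_nonneg[of 1 1] by (intro mult_mono) auto
      finally have QX: "\<bar>quadratic T t\<bar> + X \<le> M"
        using Q unfolding M_def c_def by (simp add: algebra_simps)
      have M1: "1 \<le> M"
        using mult_mono[of 1 T 1 "c * t\<^sup>2"] mult_mono[of 1 c 1 "t\<^sup>2"] T c t2 unfolding M_def by simp
      have "\<bar>(quadratic T t + X) ^ l - quadratic T t ^ l\<bar> \<le> real l * \<bar>quadratic T t + X - quadratic T t\<bar> * M ^ l"
        by (rule abs_power_diff_le) (use QX X0 M1 in auto)
      also have "\<dots> = real l * X * M ^ l" using X0 by simp
      also have "\<dots> \<le> real l * (exp 2 * exp (- (2 * T)) * logterm 1 t * c) * M ^ l"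
        using X2 M1 by (intro mult_right_mono mult_left_mono) auto
      also have "\<dots> = (real l * exp 2 * (c * c ^ l)) * (T ^ l * exp (- (2 * T))) * (t ^ (2 * l) * logterm 1 t)"
        unfolding M_def by (simp add: power_mult_distrib mult_ac flip: power_mult)
      finally show "\<bar>(quadratic T t + logterm T t) ^ l - quadratic T t ^ l\<bar> \<le> 
          (real l * exp 2 * (c * c ^ l)) * (T ^ l * exp (- (2 * T))) * (t ^ (2 * l) * logterm 1 t)"
        unfolding X_def .
    next
      show "(\<lambda>t. (quadratic T t + logterm T t) ^ l - quadratic T t ^ l) \<in> borel_measurable borel"
        by measurable
    qed simp
    also have "\<dots> = K * (T ^ l * exp (- (2 * T)))"
      unfolding K_def set_integral_mult_right by (simp only: mult_ac)
    finally show "\<bar>LINT t:{1..}|lborel. (quadratic T t + logterm T t) ^ l - quadratic T t ^ l\<bar> \<le> K * (T ^ l * exp (- (2 * T)))" .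
  qed
qed

lemma potential_integral_asymptotics:
  "\<exists>K. \<forall>T\<ge>1. set_integrable lborel {0<..<1} (\<lambda>t. potential T t ^ l) \<and>
     \<bar>(LINT t:{0<..<1}|lborel. potential T t ^ l) - (LINT t:{0<..<1}|lborel. quadratic T t ^ l)
        - 2 * (LINT t:{0<..}|lborel. (quadratic T t + logterm T t) ^ l - quadratic T t ^ l)\<bar>
     \<le> K * (T ^ l * exp (- (2 * T)))"
proof -
  obtain K1 where K1: "\<forall>T\<ge>1. set_integrable lborel {0<..<1} (\<lambda>t. potential T t ^ l) \<and>
     \<bar>(LINT t:{0<..<1}|lborel. potential T t ^ l) - (LINT t:{0<..<1}|lborel. quadratic T t ^ l)
        - 2 * (LINT t:{0<..<1}|lborel. (quadratic T t + logterm T t) ^ l - quadratic T t ^ l)\<bar>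
     \<le> K1 * (T ^ l * exp (- (2 * T)))" using potential_integral_cut by blast
  obtain K2 where K2: "\<forall>T\<ge>1. \<bar>LINT t:{1..}|lborel. (quadratic T t + logterm T t) ^ l - quadratic T t ^ l\<bar>
     \<le> K2 * (T ^ l * exp (- (2 * T)))" using excess_tail_bound by blast
  show ?thesis
  proof (intro exI[of _ "K1 + 2 * K2"] allI impI)
    fix T :: real assume T: "1 \<le> T"
    let ?f = "\<lambda>t. (quadratic T t + logterm T t) ^ l - quadratic T t ^ l"
    have int: "set_integrable lborel {0<..} ?f" using T by (intro excess_integral) auto
    have "{0<..} = {0<..<1} \<union> {1::real..}" by auto
    moreover have "(LINT t:{0<..<1} \<union> {1..}|lborel. ?f t) = (LINT t:{0<..<1}|lborel. ?f t) + (LINT t:{1..}|lborel. ?f t)"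
      by (intro set_integral_Un set_integrable_subset[OF int]) auto
    ultimately have "(LINT t:{0<..}|lborel. ?f t) = (LINT t:{0<..<1}|lborel. ?f t) + (LINT t:{1..}|lborel. ?f t)"
      by simp
    moreover note K1[rule_format, OF T] K2[rule_format, OF T]
    ultimately show "set_integrable lborel {0<..<1} (\<lambda>t. potential T t ^ l) \<and>
     \<bar>(LINT t:{0<..<1}|lborel. potential T t ^ l) - (LINT t:{0<..<1}|lborel. quadratic T t ^ l)
        - 2 * (LINT t:{0<..}|lborel. ?f t)\<bar> \<le> (K1 + 2 * K2) * (T ^ l * exp (- (2 * T)))"
      by (auto simp: distrib_right abs_le_iff)
  qed
qed

text \<open>The derivative of the segment cancels the factor 1 / \<tau>. Passing between the closed
  and open interval avoids the endpoints, where \<open>theta1\<close> vanishes.\<close>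

lemma B_eq_integral:
  assumes "0 < T" and int: "set_integrable lborel {0<..<1} (\<lambda>t. potential T t ^ l)"
  shows "B l (\<i> * of_real T / of_real pi) = of_real (LINT t:{0<..<1}|lborel. potential T t ^ l)"
proof -
  define \<tau> where "\<tau> = \<i> * of_real T / complex_of_real pi"
  have \<tau>: "\<tau> \<noteq> 0" using assms(1) by (simp add: \<tau>_def)
  have "((\<lambda>t. potential T t ^ l) has_integral (LINT t:{0<..<1}|lborel. potential T t ^ l)) {0<..<1}"
    using set_borel_integral_eq_integral[OF int] by (simp add: has_integral_integral)
  hence "((\<lambda>t. complex_of_real (potential T t ^ l)) has_integral of_real (LINT t:{0<..<1}|lborel. potential T t ^ l)) {0<..<1}"
    by (rule has_integral_of_real)
  hence "((\<lambda>t. P_B (linepath 0 \<tau> t) \<tau> ^ l / \<tau> * (\<tau> - 0)) has_integral of_real (LINT t:{0<..<1}|lborel. potential T t ^ l)) {0<..<1}"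
  proof (rule has_integral_eq[rotated])
    fix t :: real assume "t \<in> {0<..<1}"
    thus "complex_of_real (potential T t ^ l) = P_B (linepath 0 \<tau> t) \<tau> ^ l / \<tau> * (\<tau> - 0)"
      using P_B_eq[OF assms(1), of t] \<tau> by (simp add: linepath_def scaleR_conv_of_real \<tau>_def)
  qed
  hence "((\<lambda>t. P_B (linepath 0 \<tau> t) \<tau> ^ l / \<tau> * (\<tau> - 0)) has_integral of_real (LINT t:{0<..<1}|lborel. potential T t ^ l)) {0..1}"
    by (simp only: has_integral_Icc_iff_Ioo)
  thus ?thesis
    unfolding B_def contour_integral_integral vector_derivative_linepath_at \<tau>_def[symmetric]
    by (rule integral_unique)
qed

section \<open>Laurent polynomials\<close>

lemma laurent_eval_superset:
  assumes "finite K" "Poly_Mapping.keys p \<subseteq> K"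
  shows "laurent_eval p T = (\<Sum>k\<in>K. Poly_Mapping.lookup p k * T powi k)"
  unfolding laurent_eval_def using assms
  by (intro sum.mono_neutral_left) (auto simp: in_keys_iff)

lemma laurent_eval_add: "laurent_eval (p + q) T = laurent_eval p T + laurent_eval q T"
proof -
  define K where "K = Poly_Mapping.keys p \<union> Poly_Mapping.keys q"
  have K: "finite K" "Poly_Mapping.keys p \<subseteq> K" "Poly_Mapping.keys q \<subseteq> K" "Poly_Mapping.keys (p + q) \<subseteq> K"
    unfolding K_def using keys_add[of p q] by auto
  show ?thesis
    unfolding laurent_eval_superset[OF K(1,2)] laurent_eval_superset[OF K(1,3)] laurent_eval_superset[OF K(1,4)]
    by (simp add: lookup_add distrib_right sum.distrib)
qed

lemma laurent_eval_diff: "laurent_eval (p - q) T = laurent_eval p T - laurent_eval q T"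
  using laurent_eval_add[of "p - q" q T] by simp

lemma laurent_eval_zero [simp]: "laurent_eval 0 T = 0"
  by (simp add: laurent_eval_def)

lemma laurent_eval_sum: "laurent_eval (\<Sum>i\<in>I. f i) T = (\<Sum>i\<in>I. laurent_eval (f i) T)"
  by (induction I rule: infinite_finite_induct) (simp_all add: laurent_eval_add)

lemma laurent_eval_single: "laurent_eval (Poly_Mapping.single k c) T = c * T powi k"
  by (subst laurent_eval_superset[of "{k}"]) auto

text \<open>Dividing by the highest power of T makes the left side tend to the leading coefficient,
  while the exponential still forces the limit 0. This gives the uniqueness behind
  \<open>b_laurent\<close>.\<close>

lemma laurent_eval_small_imp_zero:
  assumes "laurent_eval p \<in> O[at_top](\<lambda>T. exp (- T))"
  shows "p = 0"
proof (rule ccontr)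
  assume "p \<noteq> 0"
  hence ne: "Poly_Mapping.keys p \<noteq> {}" by simp
  define m where "m = Max (Poly_Mapping.keys p)"
  have m: "m \<in> Poly_Mapping.keys p" unfolding m_def using ne by (intro Max_in) auto
  have le: "k \<le> m" if "k \<in> Poly_Mapping.keys p" for k
    unfolding m_def using that by (intro Max_ge) auto
  have "((\<lambda>T::real. \<Sum>k\<in>Poly_Mapping.keys p. Poly_Mapping.lookup p k * T powi (k - m)) \<longlongrightarrow>
      (\<Sum>k\<in>Poly_Mapping.keys p. if k = m then Poly_Mapping.lookup p m else 0)) at_top"
  proof (rule tendsto_sum)
    fix k assume k: "k \<in> Poly_Mapping.keys p"
    show "((\<lambda>T::real. Poly_Mapping.lookup p k * T powi (k - m)) \<longlongrightarrow> (if k = m then Poly_Mapping.lookup p m else 0)) at_top"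
    proof (cases "k = m")
      case False
      define n where "n = nat (m - k)"
      have n: "n > 0" "k - m = - int n" using le[OF k] False by (auto simp: n_def)
      have "((\<lambda>T::real. inverse (T ^ n)) \<longlongrightarrow> 0) at_top"
        using n by (intro tendsto_inverse_0_at_top filterlim_pow_at_top filterlim_ident) auto
      hence "((\<lambda>T::real. T powi (k - m)) \<longlongrightarrow> 0) at_top"
        unfolding n by (simp add: power_int_minus)
      from tendsto_mult_right_zero[OF this] show ?thesis using False by simp
    qed simp
  qed
  also have "(\<Sum>k\<in>Poly_Mapping.keys p. if k = m then Poly_Mapping.lookup p m else 0) = Poly_Mapping.lookup p m"
    using m by simp
  finally have lim1: "((\<lambda>T::real. \<Sum>k\<in>Poly_Mapping.keys p. Poly_Mapping.lookup p k * T powi (k - m)) \<longlongrightarrow> Poly_Mapping.lookup p m) at_top" .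
  have "((\<lambda>T::real. exp (- T) * T powi (- m)) \<longlongrightarrow> 0) at_top"
  proof -
    have "((\<lambda>T::real. T ^ nat \<bar>m\<bar> / exp T) \<longlongrightarrow> 0) at_top"
      by (rule tendsto_power_div_exp_0)
    moreover have "\<forall>\<^sub>F T::real in at_top. norm (exp (- T) * T powi (- m)) \<le> T ^ nat \<bar>m\<bar> / exp T"
      using eventually_ge_at_top[of 1]
    proof eventually_elim
      case (elim T)
      have "T powi (- m) \<le> T powi \<bar>m\<bar>" using elim by (intro power_int_increasing) auto
      also have "T powi \<bar>m\<bar> = T ^ nat \<bar>m\<bar>" by (simp add: power_int_def)
      finally show ?case using elim by (simp add: exp_minus field_simps)
    qed
    ultimately show ?thesis by (rule Lim_null_comparison[rotated])
  qed
  hence lim0: "((\<lambda>T::real. c * \<bar>exp (- T) * T powi (- m)\<bar>) \<longlongrightarrow> 0) at_top" for c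
    by (intro tendsto_mult_right_zero tendsto_rabs_zero)
  obtain c where "\<forall>\<^sub>F T in at_top. norm (laurent_eval p T) \<le> c * norm (exp (- T))"
    using assms by (elim landau_o.bigE)
  hence "\<forall>\<^sub>F T in at_top. norm (laurent_eval p T * T powi (- m)) \<le> c * \<bar>exp (- T) * T powi (- m)\<bar>"
  proof eventually_elim
    case (elim T)
    thus ?case using mult_right_mono[OF elim, of "\<bar>T powi (- m)\<bar>"] by (simp add: abs_mult mult.assoc)
  qed
  hence "((\<lambda>T. laurent_eval p T * T powi (- m)) \<longlongrightarrow> 0) at_top"
    by (rule Lim_null_comparison[OF _ lim0])
  moreover have "\<forall>\<^sub>F T in at_top. laurent_eval p T * T powi (- m) = 
      (\<Sum>k\<in>Poly_Mapping.keys p. Poly_Mapping.lookup p k * T powi (k - m))"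
    using eventually_gt_at_top[of 0]
  proof eventually_elim
    case (elim T)
    thus ?case unfolding laurent_eval_def sum_distrib_right
      by (intro sum.cong refl) (simp add: power_int_diff power_int_minus field_simps)
  qed
  ultimately have "((\<lambda>T::real. \<Sum>k\<in>Poly_Mapping.keys p. Poly_Mapping.lookup p k * T powi (k - m)) \<longlongrightarrow> 0) at_top"
    by (rule Lim_transform_eventually)
  from tendsto_unique[OF _ lim1 this] m show False by (simp add: in_keys_iff)
qed

section \<open>Identification with the explicit Laurent polynomial\<close>

lemma mzv_2: "mzv [2] = pi\<^sup>2 / 6"
proof -
  have "(\<lambda>n. 1 / real (Suc n) ^ 2) sums mzv [2]"
    using mzv_single_sums[of 2] by (subst sums_Suc_iff) simp
  moreover have "(\<lambda>n. 1 / real (Suc n) ^ 2) sums (pi\<^sup>2 / 6)"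
    using inverse_squares_sums by (simp add: add_ac)
  ultimately show ?thesis by (rule sums_unique2)
qed

lemma quad_weight_eq:
  assumes "0 < T"
  shows "quad_weight T a b c d = 
    (-1) ^ (b + d) * mzv [2] ^ d / (6 ^ c * (fact a * fact b * fact c * fact d)) * T powi (int (a + b + c) - int d)"
proof -
  have "- (pi\<^sup>2 / (6 * T)) = (-1) * (mzv [2] / T)" "- T = (-1) * T"
    by (simp_all add: mzv_2)
  moreover have "T powi (int (a + b + c) - int d) = T ^ a * T ^ b * T ^ c / T ^ d"
  proof -
    have "T powi (int (a + b + c) - int d) = T powi int (a + b + c) / T powi int d"
      using assms by (intro power_int_diff) auto
    thus ?thesis by (simp only: power_int_of_nat power_add)
  qed
  ultimately show ?thesis
    using assms unfolding quad_weight_def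
    by (simp only: power_mult_distrib power_divide power_add) (simp add: field_simps)
qed

definition asymptotic_poly :: "nat \<Rightarrow> (int \<Rightarrow>\<^sub>0 real)" where
  "asymptotic_poly l =
      (\<Sum>(a, b, c, d) \<in> {(a, b, c, d). a + b + c + d = l}.
         Poly_Mapping.single (int l - 2 * int d)
           (fact l / (fact a * fact b * fact c * fact d) *
            ((-1) ^ (b + d) * mzv [2] ^ d / (6 ^ c * real (2 * a + b + 1))))) +
      (\<Sum>(a, b, c, d, e) \<in> {(a, b, c, d, e). a + b + c + d + e = l \<and> 1 \<le> e}.
         Poly_Mapping.single (int c - int a - int d - 1)
           (fact l / (fact a * fact b * fact c * fact d) *
            ((-1) ^ (b + d) * fact (2 * a + b) * mzv [2] ^ d / (2 ^ (2 * a + b) * 6 ^ c)) *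
            H (2 * a + b + 1) e))"

text \<open>The factor 2 for the two ends of the interval reduces the 2 ^ (2 a + b + 1) of the
  moments to 2 ^ (2 a + b).\<close>

lemma laurent_eval_asymptotic_poly:
  assumes T: "0 < T"
  shows "laurent_eval (asymptotic_poly l) T = (LINT t:{0<..<1}|lborel. quadratic T t ^ l)
    + 2 * (LINT t:{0<..}|lborel. (quadratic T t + logterm T t) ^ l - quadratic T t ^ l)"
proof -
  have 1: "fact l / (fact a * fact b * fact c * fact d) *
            ((-1) ^ (b + d) * mzv [2] ^ d / (6 ^ c * real (2 * a + b + 1))) * T powi (int l - 2 * int d)
      = fact l * quad_weight T a b c d / real (2 * a + b + 1)" if "a + b + c + d = l" for l a b c d
  proof -
    have e: "int l - 2 * int d = int (a + b + c) - int d" using that by auto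
    show ?thesis unfolding e quad_weight_eq[OF T] by (simp add: mult_ac)
  qed
  have 2: "fact l / (fact a * fact b * fact c * fact d) *
            ((-1) ^ (b + d) * fact (2 * a + b) * mzv [2] ^ d / (2 ^ (2 * a + b) * 6 ^ c)) *
            H (2 * a + b + 1) e * T powi (int c - int a - int d - 1)
      = 2 * (fact l * quad_weight T a b c d * (fact (2 * a + b) / (2 * T) ^ (2 * a + b + 1) * H (2 * a + b + 1) e))"
    for l a b c d e
  proof -
    \<comment> \<open>The weight contributes T to the power a + b + c - d and the moment divides by
      T ^ (2 a + b + 1).\<close>
    have "T powi (int c - int a - int d - 1) = T powi ((int (a + b + c) - int d) - int (2 * a + b + 1))"
      by (rule arg_cong[of _ _ "\<lambda>k. T powi k"]) simp
    also have "\<dots> = T powi (int (a + b + c) - int d) / T ^ (2 * a + b + 1)"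
      using T by (subst power_int_diff) (auto simp only: power_int_of_nat)
    finally have e: "T powi (int c - int a - int d - 1) = T powi (int (a + b + c) - int d) / T ^ (2 * a + b + 1)" .
    show ?thesis unfolding e quad_weight_eq[OF T] power_mult_distrib
      by (simp add: field_simps)
  qed
  have "laurent_eval (asymptotic_poly l) T = 
      (\<Sum>(a, b, c, d)\<in>compositions4 l. fact l * quad_weight T a b c d / real (2 * a + b + 1)) +
      (\<Sum>(a, b, c, d, e)\<in>{(a, b, c, d, e). a + b + c + d + e = l \<and> 1 \<le> e}. 
        2 * (fact l * quad_weight T a b c d * (fact (2 * a + b) / (2 * T) ^ (2 * a + b + 1) * H (2 * a + b + 1) e)))"
    unfolding asymptotic_poly_def laurent_eval_add laurent_eval_sum
    by (intro arg_cong2[of _ _ _ _ "(+)"] sum.cong refl) 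
       (auto simp only: laurent_eval_single case_prod_conv 1 2 split: prod.split)
  also have "(\<Sum>(a, b, c, d, e)\<in>{(a, b, c, d, e). a + b + c + d + e = l \<and> 1 \<le> e}. 
        2 * (fact l * quad_weight T a b c d * (fact (2 * a + b) / (2 * T) ^ (2 * a + b + 1) * H (2 * a + b + 1) e))) =
     2 * (LINT t:{0<..}|lborel. (quadratic T t + logterm T t) ^ l - quadratic T t ^ l)"
    unfolding excess_integral(2)[OF T] sum_distrib_left by (simp add: case_prod_unfold)
  finally show ?thesis unfolding quadratic_power_integral .
qed

text \<open>The error is at most a constant times T ^ l exp (- 2 T); since T ^ l exp (- T) tends to
  0, one factor exp (- T) remains.\<close>

lemma B_asymptotics:
  "(\<lambda>T::real. B l (\<i> * of_real T / of_real pi) - of_real (laurent_eval (asymptotic_poly l) T))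
     \<in> O[at_top](\<lambda>T. of_real (exp (- T)))"
proof -
  obtain K where K: "\<And>T. 1 \<le> T \<Longrightarrow> set_integrable lborel {0<..<1} (\<lambda>t. potential T t ^ l) \<and>
     \<bar>(LINT t:{0<..<1}|lborel. potential T t ^ l) - (LINT t:{0<..<1}|lborel. quadratic T t ^ l)
        - 2 * (LINT t:{0<..}|lborel. (quadratic T t + logterm T t) ^ l - quadratic T t ^ l)\<bar>
     \<le> K * (T ^ l * exp (- (2 * T)))" using potential_integral_asymptotics by blast
  define f where "f = (\<lambda>T::real. B l (\<i> * of_real T / of_real pi) - of_real (laurent_eval (asymptotic_poly l) T))"
  have bound: "norm (f T) \<le> K * norm (T ^ l * exp (- (2 * T)))" if T: "1 \<le> T" for T
  proof -
    have T0: "0 < T" using T by simp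
    have "f T = of_real ((LINT t:{0<..<1}|lborel. potential T t ^ l) - laurent_eval (asymptotic_poly l) T)"
      unfolding f_def using B_eq_integral[OF T0] K[OF T] by simp
    hence "norm (f T) = \<bar>(LINT t:{0<..<1}|lborel. potential T t ^ l) - laurent_eval (asymptotic_poly l) T\<bar>"
      by (simp only: norm_of_real)
    also have "\<dots> \<le> K * (T ^ l * exp (- (2 * T)))"
      unfolding laurent_eval_asymptotic_poly[OF T0] using K[OF T] by (simp add: algebra_simps)
    finally show ?thesis using T0 by simp
  qed
  have "\<forall>\<^sub>F T in at_top. norm (norm (f T)) \<le> K * norm (T ^ l * exp (- (2 * T)))"
    using eventually_ge_at_top[of 1] by eventually_elim (use bound in simp)
  hence "(\<lambda>T. norm (f T)) \<in> O[at_top](\<lambda>T. T ^ l * exp (- (2 * T)))"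
    by (rule bigoI)
  also have "(\<lambda>T::real. T ^ l * exp (- (2 * T))) \<in> O[at_top](\<lambda>T. exp (- T))"
  proof (rule bigoI[of _ 1])
    have "((\<lambda>T::real. T ^ l / exp T) \<longlongrightarrow> 0) at_top" by (rule tendsto_power_div_exp_0)
    hence "\<forall>\<^sub>F T::real in at_top. T ^ l / exp T < 1"
      by (rule order_tendstoD) simp
    thus "\<forall>\<^sub>F T::real in at_top. norm (T ^ l * exp (- (2 * T))) \<le> 1 * norm (exp (- T))"
      using eventually_ge_at_top[of 0]
    proof eventually_elim
      case (elim T)
      have "exp (- (2 * T)) = exp (- T) * exp (- T)" by (simp flip: exp_add)
      hence "T ^ l * exp (- (2 * T)) = T ^ l / exp T * exp (- T)" by (simp add: exp_minus field_simps)
      also have "\<dots> \<le> 1 * exp (- T)" using elim by (intro mult_right_mono) auto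
      finally show ?case using elim by simp
    qed
  qed
  finally have "(\<lambda>T. norm (f T)) \<in> O[at_top](\<lambda>T. exp (- T))" .
  thus ?thesis unfolding f_def[symmetric] by (simp add: bigo_def del: of_real_exp)
qed

lemma b_laurent_eq: "b_laurent l = asymptotic_poly l"
  unfolding b_laurent_def
proof (rule the_equality)
  show "(\<lambda>T::real. B l (\<i> * of_real T / of_real pi) - of_real (laurent_eval (asymptotic_poly l) T))
     \<in> O[at_top](\<lambda>T. of_real (exp (- T)))" by (rule B_asymptotics)
  fix p assume p: "(\<lambda>T::real. B l (\<i> * of_real T / of_real pi) - of_real (laurent_eval p T))
     \<in> O[at_top](\<lambda>T. of_real (exp (- T)))"
  from sum_in_bigo(2)[OF B_asymptotics[of l] p]
  have "(\<lambda>T. complex_of_real (laurent_eval (p - asymptotic_poly l) T)) \<in> O[at_top](\<lambda>T. complex_of_real (exp (- T)))"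
    by (simp add: laurent_eval_diff)
  hence "laurent_eval (p - asymptotic_poly l) \<in> O[at_top](\<lambda>T. exp (- T))"
    by (simp add: bigo_def del: of_real_exp)
  from laurent_eval_small_imp_zero[OF this] show "p = asymptotic_poly l" by simp
qed

lemma lookup_asymptotic_poly_in_rat_span:
  "Poly_Mapping.lookup (asymptotic_poly l) k \<in> rat_span zeta_products"
proof -
  have sum: "Poly_Mapping.lookup (\<Sum>i\<in>I. f i) k \<in> rat_span zeta_products"
    if "\<And>i. i \<in> I \<Longrightarrow> Poly_Mapping.lookup (f i) k \<in> rat_span zeta_products" for f :: "'i \<Rightarrow> (int \<Rightarrow>\<^sub>0 real)" and I
    unfolding lookup_sum using that by (intro rat_span_sum)
  have single: "Poly_Mapping.lookup (Poly_Mapping.single m x) k \<in> rat_span zeta_products"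
    if "x \<in> rat_span zeta_products" for m :: int and x
    using that by (auto simp: lookup_single when_def rat_span_0)
  have zeta2: "mzv [2] ^ d \<in> rat_span zeta_products" for d
    by (intro rat_span_zeta_power mzv_single_in_rat_span) simp
  have rat: "q * z \<in> rat_span zeta_products" if "q \<in> \<rat>" "z \<in> rat_span zeta_products" for q z
    using rat_span_zeta_mult[OF rat_span_zeta_rat] that by blast
  have fact_rat: "fact n \<in> (\<rat> :: real set)" for n
    by (metis Rats_of_nat of_nat_fact)
  have "fact l / (fact a * fact b * fact c * fact d) *
      ((-1) ^ (b + d) * mzv [2] ^ d / (6 ^ c * real (2 * a + b + 1))) \<in> rat_span zeta_products" for a b c d
  proof -
    have "(fact l / (fact a * fact b * fact c * fact d) * ((-1) ^ (b + d) / (6 ^ c * real (2 * a + b + 1)))) * mzv [2] ^ d 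
        \<in> rat_span zeta_products"
      by (intro rat zeta2 Rats_mult Rats_divide Rats_power fact_rat) auto
    thus ?thesis by (simp only: times_divide_eq_left times_divide_eq_right mult_ac)
  qed
  moreover have "fact l / (fact a * fact b * fact c * fact d) *
      ((-1) ^ (b + d) * fact (2 * a + b) * mzv [2] ^ d / (2 ^ (2 * a + b) * 6 ^ c)) *
      H (2 * a + b + 1) e \<in> rat_span zeta_products" if "1 \<le> e" for a b c d e
  proof -
    have "(fact l / (fact a * fact b * fact c * fact d) * ((-1) ^ (b + d) * fact (2 * a + b) / (2 ^ (2 * a + b) * 6 ^ c))) * 
        (mzv [2] ^ d * H (2 * a + b + 1) e) \<in> rat_span zeta_products"
      by (intro rat rat_span_zeta_mult zeta2 H_in_rat_span Rats_mult Rats_divide Rats_power fact_rat) (use that in auto)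
    thus ?thesis by (simp only: times_divide_eq_left times_divide_eq_right mult_ac)
  qed
  ultimately show ?thesis
    unfolding asymptotic_poly_def lookup_add
    by (intro rat_span_add sum) (auto intro!: single)
qed

theorem theorem4:
  fixes l :: nat
  shows "(\<forall>k. Poly_Mapping.lookup (b_laurent l) k \<in> rat_span zeta_products) \<and>
    b_laurent l =
      (\<Sum>(a, b, c, d) \<in> {(a, b, c, d). a + b + c + d = l}.
         Poly_Mapping.single (int l - 2 * int d)
           (fact l / (fact a * fact b * fact c * fact d) *
            ((-1) ^ (b + d) * mzv [2] ^ d / (6 ^ c * real (2 * a + b + 1))))) +
      (\<Sum>(a, b, c, d, e) \<in> {(a, b, c, d, e). a + b + c + d + e = l \<and> 1 \<le> e}.
         Poly_Mapping.single (int c - int a - int d - 1)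
           (fact l / (fact a * fact b * fact c * fact d) *
            ((-1) ^ (b + d) * fact (2 * a + b) * mzv [2] ^ d / (2 ^ (2 * a + b) * 6 ^ c)) *
            H (2 * a + b + 1) e))"
  using lookup_asymptotic_poly_in_rat_span[of l] unfolding b_laurent_eq asymptotic_poly_def by blast

end
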